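(* Consider a left-invariant Lorentzian problem on $G=\mathrm{Aff}_+(\mathbb R)$ given by a matrix $A=\begin{pmatrix}a&b\\c&d\end{pmatrix}$, $|A|>0$, $a\ge0$, with sectional curvature $K$, and let the open set $M\subset G$, the set $N$ and the Lorentzian exponential mapping $\mathrm{Exp}$ be as defined in the context. (1) $\mathrm{Exp}(N)\subset M$. (2) $\mathrm{Exp}:N\to M$ is a diffeomorphism. (3) For any $\psi_0\in\mathbb R$ and any $t_1\in(0,t_{\max}(\psi_0))$ the extremal trajectory $\mathrm{Exp}(\psi_0,t)$, $t\in[0,t_1]$, is optimal, i.e. it is a Lorentzian length maximizer between its endpoints.
   Context: $G=\mathrm{Aff}_+(\mathbb R)=\{(x,y)\in\mathbb R^2: y>0\}$ with product $(x_2,y_2)\cdot(x_1,y_1)=(x_2+y_2x_1,\,y_2y_1)$ and identity $\mathrm{Id}=(0,1)$; left-invariant frame $X_1=y\,\partial_x$, $X_2=y\,\partial_y$. A real matrix $A=\begin{pmatrix}a&b\\c&d\end{pmatrix}$ with $|A|=ad-bc>0$ determines the left-invariant Lorentzian form $g(u_1X_1+u_2X_2)=-v_1^2+v_2^2$, $v_1=au_1+bu_2$, $v_2=cu_1+du_2$, with time orientation in which future directed nonspacelike vectors are those with $v_1\ge|v_2|$. Standing assumption of the paper: $a\ge0$. Write $A^{-1}=\begin{pmatrix}\alpha&\beta\\ \gamma&\delta\end{pmatrix}$, so $\delta\ge0$; $Y_1=\alpha X_1+\gamma X_2$, $Y_2=\beta X_1+\delta X_2$. The sectional curvature is $K=(c^2-a^2)/|A|^2=\gamma^2-\delta^2$.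 A future directed nonspacelike curve is a Lipschitz curve whose velocity is a.e. future directed nonspacelike; its length is $l=\int\sqrt{v_1^2-v_2^2}\,dt$; $J^+$ is the set of endpoints of such curves starting at $\mathrm{Id}$. A Lorentzian length maximizer is such a curve having the largest length among all such curves with the same endpoints. Lorentzian exponential mapping: for $\psi_0\in\mathbb R$ (parametrizing the initial covectors of arclength-parametrized normal extremals) let $(\psi(t),q(t))$ be the solution of $\dot\psi=\delta\cosh\psi+\gamma\sinh\psi$, $\dot q=\cosh\psi\,Y_1(q)+\sinh\psi\,Y_2(q)$, $\psi(0)=\psi_0$, $q(0)=\mathrm{Id}$, defined on its maximal interval $(t_{\min}(\psi_0),t_{\max}(\psi_0))\ni0$; put $\mathrm{Exp}(\psi_0,t)=q(t)$. Put $N=\{(\psi_0,t):\psi_0\in\mathbb R,\ 0<t<t_{\max}(\psi_0)\}$. Let $\lambda_1(x,y)=(c-a)x+(d-b)(y-1)$, $\lambda_2(x,y)=(c+a)x+(d+b)(y-1)$. If $K\ge0$, put $M=\operatorname{int}J^+$. If $K<0$, put $B=\left(\frac{d+b}{c+a},0\right)$, $\lambda_3(q)=\lambda_1(q)-\lambda_1(B)$ and $M=\operatorname{int}D$, where $D=\{q\in G:\lambda_1(q)\le0\le\lambda_2(q),\ \lambda_3(q)>0\}$, i.e. $M=\{q\in G:\lambda_1(q)<0<\lambda_2(q),\ \lambda_3(q)>0\}$. *)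

theory Defs
  imports "HOL-Analysis.Analysis"
begin

section \<open>The group and its left-invariant frame\<close>

definition Aff :: "(real \<times> real) set" where
  "Aff = {q. snd q > 0}"

definition aff_mult :: "real \<times> real \<Rightarrow> real \<times> real \<Rightarrow> real \<times> real" where
  "aff_mult q p = (fst q + snd q * fst p, snd q * snd p)"

definition aff_id :: "real \<times> real" where
  "aff_id = (0, 1)"

definition X1 :: "real \<times> real \<Rightarrow> real \<times> real" where
  "X1 q = (snd q, 0)"

definition X2 :: "real \<times> real \<Rightarrow> real \<times> real" where
  "X2 q = (0, snd q)"

text \<open>The differential of the left translation by \<open>q\<close> at any point is multiplication by \<open>snd q\<close>;
  in particular it carries \<open>X1 p\<close>, \<open>X2 p\<close> to \<open>X1 (aff_mult q p)\<close>, \<open>X2 (aff_mult q p)\<close>.\<close>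

lemma aff_mult_has_derivative: "(aff_mult q has_derivative (\<lambda>w. snd q *\<^sub>R w)) (at p)"
proof -
  have "aff_mult q = (\<lambda>p. (fst q, 0) + snd q *\<^sub>R p)"
    by (simp add: aff_mult_def fun_eq_iff)
  then show ?thesis
    by (auto intro!: derivative_eq_intros)
qed

lemma frame_left_invariant:
  "snd q *\<^sub>R X1 p = X1 (aff_mult q p)" "snd q *\<^sub>R X2 p = X2 (aff_mult q p)"
  by (simp_all add: X1_def X2_def aff_mult_def)

text \<open>The components \<open>(u\<^sub>1, u\<^sub>2)\<close> of a tangent vector \<open>w\<close> at \<open>q\<close> in the frame \<open>X1, X2\<close>.\<close>

definition frame_coords :: "real \<times> real \<Rightarrow> real \<times> real \<Rightarrow> real ^ 2" where
  "frame_coords q w = vector [fst w / snd q, snd w / snd q]"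

lemma frame_coords_unique:
  assumes "q \<in> Aff"
  shows "w = u $ 1 *\<^sub>R X1 q + u $ 2 *\<^sub>R X2 q \<longleftrightarrow> u = frame_coords q w"
  using assms
  by (auto simp: Aff_def X1_def X2_def frame_coords_def vec_eq_iff forall_2 prod_eq_iff field_simps)


section \<open>The Lorentzian structure\<close>

definition vcoords :: "real ^ 2 ^ 2 \<Rightarrow> real \<times> real \<Rightarrow> real \<times> real \<Rightarrow> real ^ 2" where
  "vcoords A q w = A *v frame_coords q w"

definition lorentz_form :: "real ^ 2 ^ 2 \<Rightarrow> real \<times> real \<Rightarrow> real \<times> real \<Rightarrow> real" where
  "lorentz_form A q w = - (vcoords A q w $ 1)\<^sup>2 + (vcoords A q w $ 2)\<^sup>2"

definition future_nonspacelike :: "real ^ 2 ^ 2 \<Rightarrow> real \<times> real \<Rightarrow> real \<times> real \<Rightarrow> bool" where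
  "future_nonspacelike A q w \<longleftrightarrow> vcoords A q w $ 1 \<ge> \<bar>vcoords A q w $ 2\<bar>"

definition curvature :: "real ^ 2 ^ 2 \<Rightarrow> real" where
  "curvature A = ((A $ 2 $ 1)\<^sup>2 - (A $ 1 $ 1)\<^sup>2) / (det A)\<^sup>2"

definition causal_curve :: "real ^ 2 ^ 2 \<Rightarrow> real \<Rightarrow> real \<Rightarrow> (real \<Rightarrow> real \<times> real) \<Rightarrow> bool" where
  "causal_curve A s t q \<longleftrightarrow>
     s \<le> t \<and> q ` {s..t} \<subseteq> Aff \<and> (\<exists>L. L-lipschitz_on {s..t} q) \<and>
     (AE \<tau> in lebesgue. \<tau> \<in> {s..t} \<longrightarrow>
        q differentiable (at \<tau>) \<and> future_nonspacelike A (q \<tau>) (vector_derivative q (at \<tau>)))"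

definition lorentz_length :: "real ^ 2 ^ 2 \<Rightarrow> real \<Rightarrow> real \<Rightarrow> (real \<Rightarrow> real \<times> real) \<Rightarrow> real" where
  "lorentz_length A s t q =
     (LINT \<tau>:{s..t}|lebesgue. sqrt (- lorentz_form A (q \<tau>) (vector_derivative q (at \<tau>))))"

definition length_maximizer :: "real ^ 2 ^ 2 \<Rightarrow> real \<Rightarrow> real \<Rightarrow> (real \<Rightarrow> real \<times> real) \<Rightarrow> bool" where
  "length_maximizer A s t q \<longleftrightarrow>
     causal_curve A s t q \<and>
     (\<forall>s' t' p. causal_curve A s' t' p \<and> p s' = q s \<and> p t' = q t \<longrightarrow>
        lorentz_length A s' t' p \<le> lorentz_length A s t q)"

definition J_plus :: "real ^ 2 ^ 2 \<Rightarrow> (real \<times> real) set" where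
  "J_plus A = {q1. \<exists>s t q. causal_curve A s t q \<and> q s = aff_id \<and> q t = q1}"


section \<open>The Lorentzian exponential mapping\<close>

definition Y1 :: "real ^ 2 ^ 2 \<Rightarrow> real \<times> real \<Rightarrow> real \<times> real" where
  "Y1 A q = matrix_inv A $ 1 $ 1 *\<^sub>R X1 q + matrix_inv A $ 2 $ 1 *\<^sub>R X2 q"

definition Y2 :: "real ^ 2 ^ 2 \<Rightarrow> real \<times> real \<Rightarrow> real \<times> real" where
  "Y2 A q = matrix_inv A $ 1 $ 2 *\<^sub>R X1 q + matrix_inv A $ 2 $ 2 *\<^sub>R X2 q"

definition extremal_on ::
  "real ^ 2 ^ 2 \<Rightarrow> real \<Rightarrow> real set \<Rightarrow> (real \<Rightarrow> real) \<Rightarrow> (real \<Rightarrow> real \<times> real) \<Rightarrow> bool" where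
  "extremal_on A \<psi>0 I \<psi> q \<longleftrightarrow>
     open I \<and> is_interval I \<and> 0 \<in> I \<and> q ` I \<subseteq> Aff \<and> \<psi> 0 = \<psi>0 \<and> q 0 = aff_id \<and>
     (\<forall>t\<in>I. (\<psi> has_real_derivative
               matrix_inv A $ 2 $ 2 * cosh (\<psi> t) + matrix_inv A $ 2 $ 1 * sinh (\<psi> t)) (at t)) \<and>
     (\<forall>t\<in>I. (q has_vector_derivative
               cosh (\<psi> t) *\<^sub>R Y1 A (q t) + sinh (\<psi> t) *\<^sub>R Y2 A (q t)) (at t))"

text \<open>Solutions are unique, so the union of all open intervals carrying a solution is the maximal
  interval of existence, and the value at \<open>t\<close> does not depend on the chosen solution.\<close>

definition max_interval :: "real ^ 2 ^ 2 \<Rightarrow> real \<Rightarrow> real set" where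
  "max_interval A \<psi>0 = \<Union>{I. \<exists>\<psi> q. extremal_on A \<psi>0 I \<psi> q}"

definition t_max :: "real ^ 2 ^ 2 \<Rightarrow> real \<Rightarrow> ereal" where
  "t_max A \<psi>0 = (SUP t\<in>max_interval A \<psi>0. ereal t)"

definition Exp :: "real ^ 2 ^ 2 \<Rightarrow> real \<times> real \<Rightarrow> real \<times> real" where
  "Exp A = (\<lambda>(\<psi>0, t). THE p. \<exists>I \<psi> q. extremal_on A \<psi>0 I \<psi> q \<and> t \<in> I \<and> q t = p)"

definition N_dom :: "real ^ 2 ^ 2 \<Rightarrow> (real \<times> real) set" where
  "N_dom A = {(\<psi>0, t). 0 < t \<and> ereal t < t_max A \<psi>0}"


section \<open>The target domain\<close>

definition lam1 :: "real ^ 2 ^ 2 \<Rightarrow> real \<times> real \<Rightarrow> real" where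
  "lam1 A q = (A $ 2 $ 1 - A $ 1 $ 1) * fst q + (A $ 2 $ 2 - A $ 1 $ 2) * (snd q - 1)"

definition lam2 :: "real ^ 2 ^ 2 \<Rightarrow> real \<times> real \<Rightarrow> real" where
  "lam2 A q = (A $ 2 $ 1 + A $ 1 $ 1) * fst q + (A $ 2 $ 2 + A $ 1 $ 2) * (snd q - 1)"

definition B_pt :: "real ^ 2 ^ 2 \<Rightarrow> real \<times> real" where
  "B_pt A = ((A $ 2 $ 2 + A $ 1 $ 2) / (A $ 2 $ 1 + A $ 1 $ 1), 0)"

definition lam3 :: "real ^ 2 ^ 2 \<Rightarrow> real \<times> real \<Rightarrow> real" where
  "lam3 A q = lam1 A q - lam1 A (B_pt A)"

definition D_dom :: "real ^ 2 ^ 2 \<Rightarrow> (real \<times> real) set" where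
  "D_dom A = {q \<in> Aff. lam1 A q \<le> 0 \<and> 0 \<le> lam2 A q \<and> lam3 A q > 0}"

definition M_dom :: "real ^ 2 ^ 2 \<Rightarrow> (real \<times> real) set" where
  "M_dom A = (if curvature A \<ge> 0 then interior (J_plus A) else interior (D_dom A))"


section \<open>Diffeomorphisms\<close>

text \<open>\<open>C_k_on k S f\<close> is the usual notion of a \<open>C\<^sup>k\<close> map only for open \<open>S\<close>.\<close>

primrec C_k_on :: "nat \<Rightarrow> 'a::euclidean_space set \<Rightarrow> ('a \<Rightarrow> 'b::euclidean_space) \<Rightarrow> bool" where
  "C_k_on 0 S f \<longleftrightarrow> continuous_on S f"
| "C_k_on (Suc k) S f \<longleftrightarrow>
     (\<forall>x\<in>S. f differentiable (at x)) \<and>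
     (\<forall>v. C_k_on k S (\<lambda>x. frechet_derivative f (at x) v))"

definition diffeomorphism_between ::
  "'a::euclidean_space set \<Rightarrow> 'b::euclidean_space set \<Rightarrow> ('a \<Rightarrow> 'b) \<Rightarrow> bool" where
  "diffeomorphism_between S T f \<longleftrightarrow>
     open S \<and> open T \<and>
     (\<exists>g. homeomorphism S T f g \<and> (\<forall>k. C_k_on k S f) \<and> (\<forall>k. C_k_on k T g))"

end

theory Submission
  imports Defs
begin

text \<open>The proof rests on two changes of coordinates that make everything explicit. With
\<open>\<xi> = -\<lambda>\<^sub>1\<close> and \<open>\<eta> = \<lambda>\<^sub>2\<close> as affine coordinates on the plane, both vanish at the identity, and the
height is \<open>y = 1 - m \<xi> + n \<eta>\<close> with \<open>m = (c + a) / (2 |A|)\<close> and \<open>n = (a - c) / (2 |A|)\<close>. Along a curve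
\<open>\<xi>' = y (v\<^sub>1 - v\<^sub>2)\<close> and \<open>\<eta>' = y (v\<^sub>1 + v\<^sub>2)\<close>, so a future directed nonspacelike curve is one along which
\<open>\<xi>\<close> and \<open>\<eta>\<close> do not decrease, and its length is the integral of \<open>sqrt (\<xi>' \<eta>') / y\<close>. The curvature is
\<open>-4 m n\<close>, and \<open>a \<ge> 0\<close> means \<open>m + n \<ge> 0\<close>.

For \<open>X = \<xi> / (1 - m \<xi>)\<close>, \<open>Z = \<eta> / (1 + n \<eta>)\<close> and \<open>k = m n\<close> the height factors as
\<open>y = (1 + k X Z) (1 - m \<xi>) (1 + n \<eta>)\<close>, and the length element becomes \<open>sqrt (dX dZ) / (1 + k X Z)\<close>,
which is invariant under \<open>(X, Z) \<mapsto> (X / w, w Z)\<close>. In these coordinates the extremal with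
\<open>w = exp \<psi>\<^sub>0\<close> is the ray \<open>Z = w\<^sup>2 X\<close>, traversed so that \<open>sqrt (X Z)\<close> is the tangent of curvature \<open>k\<close> at
time \<open>t\<close>. Therefore \<open>\<psi>\<^sub>0 = ln (Z / X) / 2\<close> and \<open>t = arctan\<^sub>k (sqrt (X Z))\<close> invert the exponential mapping
by elementary functions (\<open>geo_in_null_region\<close>, \<open>Log_in_N_dom\<close>), and its image is the set where
\<open>\<xi>\<close>, \<open>\<eta>\<close>, \<open>1 - m \<xi>\<close>, \<open>1 + n \<eta>\<close> and \<open>y\<close> are positive. This set equals \<open>M\<close> for either sign of the
curvature (\<open>M_dom_eq\<close>).

That the explicit curves are all the solutions follows because the Riccati equation for \<open>exp \<psi>\<close> is
linearised by a pair of functions \<open>P, Q\<close> with \<open>exp \<psi> = P / Q\<close>. The maximal interval of existence is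
the component of \<open>0\<close> in \<open>{P > 0, Q > 0}\<close>, and there \<open>\<xi>\<close>, \<open>\<eta>\<close>, \<open>y\<close> are rational in \<open>P\<close>, \<open>Q\<close> and the sine of
curvature \<open>k\<close> (\<open>null_geodesic_unique\<close>).

Optimality is a calibration argument (\<open>lorentz_length_le\<close>): by the inequality of the arithmetic and
geometric means, \<open>t = arctan\<^sub>k (sqrt (X Z))\<close> grows along every future directed nonspacelike curve at
least as fast as its length. While the curve still runs on the light cone of the identity, where \<open>t\<close>
is not smooth, its length element vanishes. Since \<open>t\<close> is monotone along the curve, integrating the pointwise
comparison is legitimate: the integral of the derivative of a monotone function never exceeds its
increment.\<close>

section \<open>Maps of class \<open>C\<^sup>k\<close>\<close>

lemma C_k_on_cong:
  assumes "open S" "\<And>x. x \<in> S \<Longrightarrow> f x = g x" "C_k_on k S f"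
  shows "C_k_on k S g"
  using assms(2,3)
proof (induction k arbitrary: f g)
  case 0
  then show ?case using continuous_on_cong by (metis C_k_on.simps(1))
next
  case (Suc k)
  have der: "(g has_derivative frechet_derivative f (at x)) (at x)" if "x \<in> S" for x
    using Suc.prems that \<open>open S\<close> frechet_derivative_works
    by (metis C_k_on.simps(2) has_derivative_transform_within_open)
  have eq: "frechet_derivative f (at x) = frechet_derivative g (at x)" if "x \<in> S" for x
    using frechet_derivative_at[OF der[OF that]] .
  have "C_k_on k S (\<lambda>x. frechet_derivative g (at x) v)" for v
    by (rule Suc.IH[of "\<lambda>x. frechet_derivative f (at x) v"]) (use Suc.prems eq in auto)
  then show ?case using der by (auto simp: differentiable_def)
qed

text \<open>The recursion for \<open>C_k_on\<close> speaks of the Frechet derivative chosen by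
  \<open>frechet_derivative\<close>. This rule and the next lemma trade it for any derivative that is at hand.\<close>

lemma C_k_on_SucI:
  assumes "open S" "\<And>x. x \<in> S \<Longrightarrow> (f has_derivative f' x) (at x)"
    and "\<And>v. C_k_on k S (\<lambda>x. f' x v)"
  shows "C_k_on (Suc k) S f"
proof -
  have "C_k_on k S (\<lambda>x. frechet_derivative f (at x) v)" for v
    by (rule C_k_on_cong[OF \<open>open S\<close> _ assms(3)[of v]])
      (use assms(2) frechet_derivative_at in metis)
  then show ?thesis using assms(2) by (auto simp: differentiable_def)
qed

lemma C_k_on_SucD:
  assumes "C_k_on (Suc k) S f"
  obtains f' where "\<And>x. x \<in> S \<Longrightarrow> (f has_derivative f' x) (at x)"
    and "\<And>v. C_k_on k S (\<lambda>x. f' x v)"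
  using assms that[of "\<lambda>x. frechet_derivative f (at x)"] frechet_derivative_works by auto

lemma C_k_on_Suc_imp: "C_k_on (Suc k) S f \<Longrightarrow> C_k_on k S f"
proof (induction k arbitrary: f)
  case 0
  then show ?case
    by (auto intro!: continuous_at_imp_continuous_on differentiable_imp_continuous_within)
next
  case (Suc k)
  then show ?case by (metis C_k_on.simps(2))
qed

lemma C_k_on_const: "C_k_on k S (\<lambda>x. c)"
  by (induction k arbitrary: c) auto

lemma C_k_on_bounded_linear:
  assumes "bounded_linear f"
  shows "C_k_on k S f"
proof (cases k)
  case 0
  then show ?thesis using assms by (simp add: linear_continuous_on)
next
  case (Suc j)
  have "frechet_derivative f (at x) = f" for x
    using assms bounded_linear_imp_has_derivative frechet_derivative_at by metis
  then show ?thesis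
    using assms Suc by (auto simp: C_k_on_const intro: bounded_linear_imp_differentiable)
qed

lemma C_k_on_linear_compose:
  assumes "open S" "bounded_linear h" "C_k_on k S f"
  shows "C_k_on k S (\<lambda>x. h (f x))"
  using assms(3)
proof (induction k arbitrary: f)
  case 0
  then show ?case using assms(2) by (simp add: bounded_linear.continuous_on)
next
  case (Suc k)
  obtain f' where f': "\<And>x. x \<in> S \<Longrightarrow> (f has_derivative f' x) (at x)"
    "\<And>v. C_k_on k S (\<lambda>x. f' x v)" using C_k_on_SucD[OF Suc.prems] by blast
  show ?case
    by (rule C_k_on_SucI[where f' = "\<lambda>x v. h (f' x v)", OF \<open>open S\<close>])
      (use f' Suc.IH in \<open>auto intro: bounded_linear.has_derivative[OF assms(2)]\<close>)
qed

lemma C_k_on_add: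
  assumes "open S" "C_k_on k S f" "C_k_on k S g"
  shows "C_k_on k S (\<lambda>x. f x + g x)"
  using assms(2,3)
proof (induction k arbitrary: f g)
  case 0
  then show ?case by (simp add: continuous_on_add)
next
  case (Suc k)
  obtain f' where f': "\<And>x. x \<in> S \<Longrightarrow> (f has_derivative f' x) (at x)"
    "\<And>v. C_k_on k S (\<lambda>x. f' x v)" using C_k_on_SucD[OF Suc.prems(1)] by blast
  obtain g' where g': "\<And>x. x \<in> S \<Longrightarrow> (g has_derivative g' x) (at x)"
    "\<And>v. C_k_on k S (\<lambda>x. g' x v)" using C_k_on_SucD[OF Suc.prems(2)] by blast
  show ?case
    by (rule C_k_on_SucI[where f' = "\<lambda>x v. f' x v + g' x v", OF \<open>open S\<close>])
      (use f' g' Suc.IH in \<open>auto intro: has_derivative_add\<close>)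
qed

text \<open>The product rule expresses the derivative by products of maps of class \<open>C\<^sup>k\<close>, so induction on \<open>k\<close>
closes once \<open>C\<^sup>k\<^sup>+\<^sup>1\<close> is known to imply \<open>C\<^sup>k\<close> for the undifferentiated factor.\<close>

lemma C_k_on_mult:
  fixes f g :: "'a::euclidean_space \<Rightarrow> real"
  assumes "open S" "C_k_on k S f" "C_k_on k S g"
  shows "C_k_on k S (\<lambda>x. f x * g x)"
  using assms(2,3)
proof (induction k arbitrary: f g)
  case 0
  then show ?case by (simp add: continuous_on_mult)
next
  case (Suc k)
  obtain f' where f': "\<And>x. x \<in> S \<Longrightarrow> (f has_derivative f' x) (at x)"
    "\<And>v. C_k_on k S (\<lambda>x. f' x v)" using C_k_on_SucD[OF Suc.prems(1)] by blast
  obtain g' where g': "\<And>x. x \<in> S \<Longrightarrow> (g has_derivative g' x) (at x)"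
    "\<And>v. C_k_on k S (\<lambda>x. g' x v)" using C_k_on_SucD[OF Suc.prems(2)] by blast
  show ?case
    by (rule C_k_on_SucI[where f' = "\<lambda>x v. f x * g' x v + f' x v * g x", OF \<open>open S\<close>])
      (use f' g' Suc.IH Suc.prems[THEN C_k_on_Suc_imp]
        in \<open>auto intro!: has_derivative_mult C_k_on_add[OF \<open>open S\<close>]\<close>)
qed

lemma C_k_on_diff:
  fixes f g :: "'a::euclidean_space \<Rightarrow> 'b::euclidean_space"
  assumes "open S" "C_k_on k S f" "C_k_on k S g"
  shows "C_k_on k S (\<lambda>x. f x - g x)"
  using C_k_on_add[OF assms(1,2) C_k_on_linear_compose[OF assms(1) bounded_linear_minus[OF bounded_linear_ident] assms(3)]]
  by simp

lemma C_k_on_Pair: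
  fixes f :: "'a::euclidean_space \<Rightarrow> 'b::euclidean_space"
    and g :: "'a \<Rightarrow> 'c::euclidean_space"
  assumes "open S" "C_k_on k S f" "C_k_on k S g"
  shows "C_k_on k S (\<lambda>x. (f x, g x))"
proof -
  have "bounded_linear (\<lambda>x. (x, 0) :: 'b \<times> 'c)" "bounded_linear (\<lambda>x. (0, x) :: 'b \<times> 'c)"
    by (intro bounded_linear_Pair bounded_linear_ident bounded_linear_zero)+
  from C_k_on_add[OF assms(1) C_k_on_linear_compose[OF assms(1) this(1) assms(2)]
      C_k_on_linear_compose[OF assms(1) this(2) assms(3)]]
  show ?thesis by simp
qed

text \<open>All nonlinear functions below act on a single real argument. With real-valued \<open>f\<close> the chain rule
is a product of two real functions, which avoids a composition lemma for general \<open>C\<^sup>k\<close> maps.\<close>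

lemma C_k_on_compose_real:
  fixes f :: "'a::euclidean_space \<Rightarrow> real" and h :: "real \<Rightarrow> real"
  assumes "open S" "f ` S \<subseteq> T" "C_k_on k S f" "C_k_on k T h"
  shows "C_k_on k S (\<lambda>x. h (f x))"
  using assms(3,4)
proof (induction k arbitrary: h)
  case 0
  then show ?case using assms(2) continuous_on_compose2 by (metis C_k_on.simps(1))
next
  case (Suc k)
  obtain f' where f': "\<And>x. x \<in> S \<Longrightarrow> (f has_derivative f' x) (at x)"
    "\<And>v. C_k_on k S (\<lambda>x. f' x v)" using C_k_on_SucD[OF Suc.prems(1)] by blast
  obtain h' where h': "\<And>x. x \<in> T \<Longrightarrow> (h has_derivative h' x) (at x)"
    "\<And>v. C_k_on k T (\<lambda>x. h' x v)" using C_k_on_SucD[OF Suc.prems(2)] by blast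
  have der: "((\<lambda>x. h (f x)) has_derivative (\<lambda>v. f' x v * h' (f x) 1)) (at x)" if "x \<in> S" for x
  proof -
    have "f x \<in> T" using that assms(2) by auto
    then have "((\<lambda>x. h (f x)) has_derivative (\<lambda>v. h' (f x) (f' x v))) (at x)"
      using f'(1)[OF that] h'(1) has_derivative_compose by blast
    moreover have "h' (f x) (f' x v) = f' x v * h' (f x) 1" for v
      using linear_scale[OF has_derivative_linear[OF h'(1)[OF \<open>f x \<in> T\<close>]], of "f' x v" 1] by simp
    ultimately show ?thesis by simp
  qed
  show ?case
    by (rule C_k_on_SucI[where f' = "\<lambda>x v. f' x v * h' (f x) 1", OF \<open>open S\<close> der])
      (auto intro!: C_k_on_mult[OF \<open>open S\<close>] f'(2) Suc.IH h'(2) C_k_on_Suc_imp[OF Suc.prems(1)])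
qed

lemma C_k_on_real_SucI:
  fixes h h' :: "real \<Rightarrow> real"
  assumes "open T" "\<And>x. x \<in> T \<Longrightarrow> (h has_real_derivative h' x) (at x)" "C_k_on k T h'"
  shows "C_k_on (Suc k) T h"
  by (rule C_k_on_SucI[where f' = "\<lambda>x v. h' x * v", OF assms(1)])
    (use assms in \<open>auto simp: has_field_derivative_def intro: C_k_on_mult C_k_on_const\<close>)

lemma C_k_on_exp: "C_k_on k UNIV (exp :: real \<Rightarrow> real)"
proof (induction k)
  case 0
  then show ?case by (simp add: continuous_on_exp)
next
  case (Suc k)
  then show ?case by (intro C_k_on_real_SucI[where h' = exp]) auto
qed

lemma C_k_on_inverse: "C_k_on k (- {0}) (inverse :: real \<Rightarrow> real)"
proof (induction k)
  case 0
  then show ?case by (simp add: continuous_on_inverse)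
next
  case (Suc k)
  have "C_k_on k (- {0}) (\<lambda>x::real. (- 1) * (inverse x * inverse x))"
    by (intro C_k_on_mult Suc C_k_on_const) auto
  then show ?case
    by (rule C_k_on_real_SucI[rotated 2]) (auto intro!: derivative_eq_intros)
qed

lemma C_k_on_ln: "C_k_on k {0<..} (ln :: real \<Rightarrow> real)"
proof (cases k)
  case 0
  then show ?thesis by (auto intro!: continuous_intros)
next
  case (Suc j)
  have "C_k_on j {0<..} (\<lambda>x::real. inverse x)"
    by (rule C_k_on_compose_real[OF _ _ C_k_on_bounded_linear C_k_on_inverse, where f = "\<lambda>x. x"])
      (auto intro: bounded_linear_ident)
  then show ?thesis unfolding Suc
    by (rule C_k_on_real_SucI[rotated 2]) (auto intro!: derivative_eq_intros simp: field_simps)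
qed

text \<open>Near any positive number the square root is \<open>exp (ln x / 2)\<close>.\<close>

lemma C_k_on_sqrt: "C_k_on k {0<..} (sqrt :: real \<Rightarrow> real)"
proof -
  have "C_k_on k {0<..} (\<lambda>x::real. exp (1/2 * ln x))"
    by (intro C_k_on_compose_real[OF _ _ _ C_k_on_exp] C_k_on_mult C_k_on_const C_k_on_ln) auto
  then show ?thesis
    by (rule C_k_on_cong[rotated 2])
      (auto simp: powr_half_sqrt[symmetric] powr_def)
qed

lemma C_k_on_divide:
  fixes f g :: "'a::euclidean_space \<Rightarrow> real"
  assumes "open S" "C_k_on k S f" "C_k_on k S g" "\<And>x. x \<in> S \<Longrightarrow> g x \<noteq> 0"
  shows "C_k_on k S (\<lambda>x. f x / g x)"
  unfolding divide_inverse
  by (intro C_k_on_mult C_k_on_compose_real[OF _ _ _ C_k_on_inverse]) (use assms in auto)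

section \<open>Integrating the derivative of a monotone function\<close>

text \<open>By a shift of the variable, the integral is the difference of the means of \<open>g\<close> over \<open>[t, t + e]\<close>
and over \<open>[s, s + e]\<close>, and these means are bounded by the extreme values \<open>g t\<close> and \<open>g s\<close>.\<close>

lemma mono_difference_quotient_integral:
  fixes g :: "real \<Rightarrow> real"
  assumes g: "mono g" and "s \<le> t" and upper: "\<And>x. g x \<le> g t" and lower: "\<And>x. g s \<le> g x" and "e > 0"
  shows "(\<integral>\<^sup>+x. ennreal (indicator {s..t} x * ((g (x + e) - g x) / e)) \<partial>lborel) \<le> ennreal (g t - g s)"
proof -
  have int: "g integrable_on {u..v}" for u v
    using g by (auto intro!: integrable_on_mono_on simp: mono_on_def mono_def)
  define I where "I u v = integral {u..v} g" for u v
  have I: "(g has_integral I u v) {u..v}" for u v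
    using int by (simp add: I_def has_integral_integral)
  have "((\<lambda>x. g (x + e)) has_integral I (s+e) (t+e)) {s..t}"
    using has_integral_affinity'[of g "I (s+e) (t+e)" "s+e" "t+e" 1 e] I by simp
  from has_integral_divide[OF has_integral_diff[OF this I], of e]
  have D: "((\<lambda>x. (g (x + e) - g x) / e) has_integral (I (s+e) (t+e) - I s t) / e) {s..t}" .
  have "I s (s+e) + I (s+e) (t+e) = I s t + I t (t+e)"
    unfolding I_def using assms(2,5)
    by (simp add: Henstock_Kurzweil_Integration.integral_combine int)
  moreover have "I t (t+e) \<le> e * g t"
    using has_integral_le[OF I has_integral_const_real[of "g t" t "t+e"]] upper assms(5) by simp
  moreover have "e * g s \<le> I s (s+e)"
    using has_integral_le[OF has_integral_const_real[of "g s" s "s+e"] I] lower assms(5) by simp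
  ultimately have le: "(I (s+e) (t+e) - I s t) / e \<le> g t - g s"
    using assms(5) by (simp add: field_simps)
  have nn: "0 \<le> (g (x + e) - g x) / e" for x
    using monoD[OF g, of x "x+e"] assms(5) by simp
  have "(\<integral>\<^sup>+x. ennreal (indicator {s..t} x * ((g (x + e) - g x) / e)) \<partial>lborel)
    = ennreal ((I (s+e) (t+e) - I s t) / e)"
    by (rule nn_integral_has_integral_lebesgue[OF _ D]) (rule nn)
  then show ?thesis using le by (simp add: ennreal_leI)
qed

text \<open>Fatou's lemma for the difference quotients of \<open>G\<close>, which are nonnegative. Only lower bounds for the
limit inferior are needed, so \<open>G\<close> may fail to be differentiable wherever \<open>h\<close> vanishes. A
nonintegrable \<open>h\<close> has integral \<open>0\<close> by convention and satisfies the bound too.\<close>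

lemma integral_derivative_mono_le:
  fixes G h :: "real \<Rightarrow> real"
  assumes "s \<le> t" and G: "mono_on {s..t} G"
    and h: "AE x in lebesgue. x \<in> {s<..<t} \<longrightarrow>
      h x = 0 \<or> (\<exists>D. (G has_real_derivative D) (at x) \<and> 0 \<le> h x \<and> h x \<le> D)"
  shows "(LINT x:{s..t}|lebesgue. h x) \<le> G t - G s"
proof -
  (* The difference quotients look beyond t, so G is continued by constants. *)
  define g where "g x = G (max s (min t x))" for x
  have g: "mono g"
    using G \<open>s \<le> t\<close> by (auto simp: g_def mono_def intro!: mono_onD[OF G])
  have ends: "g t = G t" "g s = G s" using \<open>s \<le> t\<close> by (auto simp: g_def)
  have upper: "g x \<le> g t" and lower: "g s \<le> g x" for x
    unfolding g_def using \<open>s \<le> t\<close> by (auto intro!: mono_onD[OF G])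
  define e where "e i = inverse (real (Suc i))" for i
  have e: "e i > 0" for i by (simp add: e_def)
  have e0: "e \<longlonglongrightarrow> 0" unfolding e_def by (rule LIMSEQ_inverse_real_of_nat)
  define u where "u i x = ennreal (indicator {s..t} x * ((g (x + e i) - g x) / e i))" for i x
  have [measurable]: "g \<in> borel_measurable borel" by (rule borel_measurable_mono[OF g])
  have um [measurable]: "u i \<in> borel_measurable borel" for i unfolding u_def by measurable
  have lim: "ennreal (h x) \<le> liminf (\<lambda>i. u i x)"
    if x: "x \<in> {s<..<t}" and D: "(G has_real_derivative D) (at x)" "0 \<le> h x" "h x \<le> D" for x D
  proof -
    have "(g has_real_derivative D) (at x)"
      by (rule has_field_derivative_transform_within_open[OF D(1), of "{s<..<t}"])
        (use x in \<open>auto simp: g_def\<close>)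
    then have "((\<lambda>d. (g (x + d) - g x) / d) \<longlongrightarrow> D) (at 0)" by (simp add: DERIV_def)
    moreover have "filterlim e (at 0) sequentially"
      unfolding filterlim_at using e0 e by (auto simp: less_imp_neq[symmetric])
    ultimately have "(\<lambda>i. (g (x + e i) - g x) / e i) \<longlonglongrightarrow> D"
      by (rule filterlim_compose)
    then have "(\<lambda>i. u i x) \<longlonglongrightarrow> ennreal D"
      unfolding u_def using x by (auto intro!: tendsto_ennrealI)
    then have "liminf (\<lambda>i. u i x) = ennreal D" by (simp add: lim_imp_Liminf)
    then show ?thesis using D by (simp add: ennreal_leI)
  qed
  have "(\<integral>\<^sup>+x. ennreal (indicator {s..t} x * h x) \<partial>lebesgue) \<le> (\<integral>\<^sup>+x. liminf (\<lambda>i. u i x) \<partial>lebesgue)"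
  proof (rule nn_integral_mono_AE)
    have "AE x in lebesgue. x \<noteq> s" "AE x in lebesgue. x \<noteq> t"
      by (auto intro: AE_completion AE_lborel_singleton)
    with h show "AE x in lebesgue. ennreal (indicator {s..t} x * h x) \<le> liminf (\<lambda>i. u i x)"
    proof eventually_elim
      case (elim x)
      show ?case
      proof (cases "x \<in> {s..t} \<and> h x \<noteq> 0")
        case True
        then show ?thesis using elim lim[of x] by fastforce
      qed auto
    qed
  qed
  also have "\<dots> = (\<integral>\<^sup>+x. liminf (\<lambda>i. u i x) \<partial>lborel)"
    by (rule nn_integral_completion)
  also have "\<dots> \<le> liminf (\<lambda>i. \<integral>\<^sup>+x. u i x \<partial>lborel)"
    by (rule nn_integral_liminf) simp
  also have "\<dots> \<le> liminf (\<lambda>i::nat. ennreal (G t - G s))"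
    unfolding u_def ends[symmetric]
    by (intro Liminf_mono always_eventually allI mono_difference_quotient_integral)
      (use g \<open>s \<le> t\<close> upper lower e in auto)
  finally have "(\<integral>\<^sup>+x. ennreal (indicator {s..t} x * h x) \<partial>lebesgue) \<le> ennreal (G t - G s)"
    by (simp add: Liminf_const)
  then show ?thesis
    unfolding set_lebesgue_integral_def
    by (intro integral_real_bounded) (use lower[of t] ends in auto)
qed

text \<open>Adding \<open>L x\<close> makes an \<open>L\<close>-Lipschitz function monotone and raises its derivative to at least \<open>L\<close>;
the previous bound then gives back \<open>L (r - p)\<close> out of the increment of \<open>f x + L x\<close>.\<close>

lemma lipschitz_nonneg_derivative_mono:
  fixes f :: "real \<Rightarrow> real"
  assumes L: "L-lipschitz_on {s..t} f"
    and f: "AE x in lebesgue. x \<in> {s..t} \<longrightarrow> (\<exists>D\<ge>0. (f has_real_derivative D) (at x))"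
  shows "mono_on {s..t} f"
proof (rule mono_onI)
  fix p r assume pr: "p \<in> {s..t}" "r \<in> {s..t}" "p \<le> r"
  have L0: "0 \<le> L" using L by (rule lipschitz_on_nonneg)
  have "mono_on {p..r} (\<lambda>x. f x + L * x)"
  proof (rule mono_onI)
    fix x y assume "x \<in> {p..r}" "y \<in> {p..r}" "x \<le> y"
    then have "\<bar>f y - f x\<bar> \<le> L * (y - x)"
      using lipschitz_onD[OF L, of y x] pr by (auto simp: dist_real_def)
    then show "f x + L * x \<le> f y + L * y" by (simp add: algebra_simps abs_le_iff)
  qed
  then have "(LINT x:{p..r}|lebesgue. L) \<le> (f r + L * r) - (f p + L * p)"
  proof (rule integral_derivative_mono_le[OF \<open>p \<le> r\<close>])
    show "AE x in lebesgue. x \<in> {p<..<r} \<longrightarrow> L = 0 \<or>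
        (\<exists>D. ((\<lambda>x. f x + L * x) has_real_derivative D) (at x) \<and> 0 \<le> L \<and> L \<le> D)"
      using f
    proof eventually_elim
      case (elim x)
      show ?case
      proof
        assume "x \<in> {p<..<r}"
        then obtain D where D: "D \<ge> 0" "(f has_real_derivative D) (at x)" using elim pr by auto
        have "((\<lambda>x. f x + L * x) has_real_derivative D + L) (at x)"
          using D by (auto intro!: derivative_eq_intros)
        then show "L = 0 \<or> (\<exists>D. ((\<lambda>x. f x + L * x) has_real_derivative D) (at x) \<and> 0 \<le> L \<and> L \<le> D)"
          using D L0 by (intro disjI2 exI[of _ "D + L"]) auto
      qed
    qed
  qed
  moreover have "(LINT x:{p..r}|lebesgue. L) = L * (r - p)"
    using pr by (simp add: set_integral_const)
  ultimately show "f p \<le> f r" by (simp add: algebra_simps)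
qed

section \<open>Trigonometry of curvature k\<close>

text \<open>Solutions of \<open>s'' = - k s\<close>, which treat positive, zero and negative curvature uniformly.\<close>

definition gsin :: "real \<Rightarrow> real \<Rightarrow> real" where
  "gsin k t = (if k > 0 then sin (sqrt k * t) / sqrt k
     else if k = 0 then t else sinh (sqrt (- k) * t) / sqrt (- k))"

definition gcos :: "real \<Rightarrow> real \<Rightarrow> real" where
  "gcos k t = (if k > 0 then cos (sqrt k * t)
     else if k = 0 then 1 else cosh (sqrt (- k) * t))"

definition gatan :: "real \<Rightarrow> real \<Rightarrow> real" where
  "gatan k x = (if k > 0 then arctan (sqrt k * x) / sqrt k
     else if k = 0 then x else artanh (sqrt (- k) * x) / sqrt (- k))"

text \<open>The largest interval \<open>(0, T)\<close> on which both \<open>gsin k\<close> and \<open>gcos k\<close> are positive.\<close>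

definition gdom :: "real \<Rightarrow> real set" where
  "gdom k = {t. 0 < t \<and> (k > 0 \<longrightarrow> sqrt k * t < pi / 2)}"

lemma gsin_0 [simp]: "gsin k 0 = 0" and gcos_0 [simp]: "gcos k 0 = 1"
  and gatan_0 [simp]: "gatan k 0 = 0"
  by (auto simp: gsin_def gcos_def gatan_def)

lemma gsin_has_derivative: "(gsin k has_real_derivative gcos k t) (at t)"
proof (cases "k > 0")
  case True
  have "((\<lambda>t. sin (sqrt k * t) / sqrt k) has_real_derivative cos (sqrt k * t) * sqrt k / sqrt k) (at t)"
    by (intro DERIV_cdivide) (auto intro!: derivative_eq_intros)
  with True show ?thesis unfolding gsin_def gcos_def by simp
next
  case False
  have "((\<lambda>t. sinh (sqrt (-k) * t) / sqrt (-k)) has_real_derivative cosh (sqrt (-k) * t) * sqrt (-k) / sqrt (-k)) (at t)"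
    by (intro DERIV_cdivide) (auto intro!: derivative_eq_intros)
  with False show ?thesis unfolding gsin_def gcos_def by (cases "k = 0") auto
qed

lemma gcos_has_derivative: "(gcos k has_real_derivative - k * gsin k t) (at t)"
proof (cases "k > 0")
  case True
  then have "- sin (sqrt k * t) * sqrt k = - k * (sin (sqrt k * t) / sqrt k)"
    by (simp add: field_simps flip: power2_eq_square)
  with True show ?thesis unfolding gsin_def gcos_def
    by (auto intro!: derivative_eq_intros)
next
  case False
  have "k < 0 \<Longrightarrow> sinh (sqrt (-k) * t) * sqrt (-k) = - k * (sinh (sqrt (-k) * t) / sqrt (-k))"
    using real_div_sqrt[of "- k"] times_divide_eq_left times_divide_eq_right mult.commute
    by (metis less_imp_le neg_0_le_iff_le)
  with False show ?thesis unfolding gsin_def gcos_def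
    by (cases "k = 0") (auto intro!: derivative_eq_intros)
qed

lemma gcos_gsin_squares: "(gcos k t)\<^sup>2 + k * (gsin k t)\<^sup>2 = 1"
proof (cases "k > 0")
  case True
  then show ?thesis by (simp add: gcos_def gsin_def power_divide)
next
  case False
  then show ?thesis
    by (cases "k = 0") (simp_all add: gcos_def gsin_def power_divide cosh_square_eq)
qed

text \<open>The two functions are, up to constants, derivatives of each other, so they are handled jointly.\<close>

lemma C_k_on_gsin_gcos: "C_k_on j UNIV (gsin k) \<and> C_k_on j UNIV (gcos k)"
proof (induction j)
  case 0
  show ?case
    using DERIV_isCont[OF gsin_has_derivative] DERIV_isCont[OF gcos_has_derivative]
    by (auto intro!: continuous_at_imp_continuous_on)
next
  case (Suc j)
  have "C_k_on j UNIV (\<lambda>t. - k * gsin k t)"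
    using Suc by (intro C_k_on_mult C_k_on_const) auto
  with Suc show ?case
    using C_k_on_real_SucI[of UNIV "gsin k" "gcos k" j]
      C_k_on_real_SucI[of UNIV "gcos k" "\<lambda>t. - k * gsin k t" j]
      gsin_has_derivative gcos_has_derivative by auto
qed

lemma gsin_gcos_pos:
  assumes "t \<in> gdom k"
  shows "gsin k t > 0" "gcos k t > 0"
proof -
  have "0 < t" "k > 0 \<Longrightarrow> sqrt k * t < pi / 2" using assms by (auto simp: gdom_def)
  then show "gsin k t > 0" "gcos k t > 0"
    unfolding gsin_def gcos_def by (auto intro!: sin_gt_zero2 cos_gt_zero divide_pos_pos)
qed

lemma gdom_downward: "t \<in> gdom k \<Longrightarrow> 0 < r \<Longrightarrow> r \<le> t \<Longrightarrow> r \<in> gdom k"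
  unfolding gdom_def mem_Collect_eq
  by (metis le_less_trans mult_left_mono less_imp_le real_sqrt_ge_zero)

lemma open_gdom: "open (gdom k)"
proof (cases "k > 0")
  case True
  then have "gdom k = {0<..} \<inter> {t. sqrt k * t < pi / 2}" by (auto simp: gdom_def)
  then show ?thesis by (auto intro!: open_Int open_Collect_less continuous_intros)
next
  case False
  then have "gdom k = {0<..}" by (auto simp: gdom_def)
  then show ?thesis by simp
qed

lemma gtan_mono:
  assumes "t \<in> gdom k" "0 < r" "r \<le> t"
  shows "gsin k r / gcos k r \<le> gsin k t / gcos k t"
proof (rule DERIV_nonneg_imp_nondecreasing[OF \<open>r \<le> t\<close>])
  fix x assume x: "r \<le> x" "x \<le> t"
  then have "x \<in> gdom k" using gdom_downward[OF assms(1)] assms(2) by auto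
  then have c: "gcos k x > 0" using gsin_gcos_pos by blast
  have "((\<lambda>x. gsin k x / gcos k x) has_real_derivative
      (gcos k x * gcos k x - gsin k x * (- k * gsin k x)) / (gcos k x * gcos k x)) (at x)"
    using c by (intro DERIV_divide gsin_has_derivative gcos_has_derivative) auto
  moreover have "gcos k x * gcos k x - gsin k x * (- k * gsin k x) = 1"
    using gcos_gsin_squares[of k x] by (simp add: power2_eq_square algebra_simps)
  ultimately show "\<exists>y. ((\<lambda>x. gsin k x / gcos k x) has_real_derivative y) (at x) \<and> 0 \<le> y"
    using c by auto
qed

lemma gatan_gtan:
  assumes "t \<in> gdom k"
  shows "gatan k (gsin k t / gcos k t) = t"
proof -
  have t: "0 < t" "k > 0 \<Longrightarrow> sqrt k * t < pi / 2" using assms by (auto simp: gdom_def)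
  consider "k > 0" | "k = 0" | "k < 0" by linarith
  then show ?thesis
  proof cases
    case 1
    have "arctan (sin (sqrt k * t) / cos (sqrt k * t)) = sqrt k * t"
    proof -
      have "0 < sqrt k * t" using t 1 by simp
      then have "- (pi / 2) < sqrt k * t" using pi_gt_zero by linarith
      then show ?thesis using t(2)[OF 1] arctan_tan[of "sqrt k * t"] by (simp add: tan_def)
    qed
    with 1 show ?thesis by (simp add: gatan_def gsin_def gcos_def)
  next
    case 3
    have "artanh (sinh (sqrt (-k) * t) / cosh (sqrt (-k) * t)) = sqrt (-k) * t"
      using artanh_tanh_real[of "sqrt (-k) * t"] by (simp add: tanh_def)
    with 3 show ?thesis by (simp add: gatan_def gsin_def gcos_def)
  qed (simp add: gatan_def gsin_def gcos_def)
qed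

text \<open>For \<open>k < 0\<close> the condition \<open>1 + k x\<^sup>2 > 0\<close> is exactly membership in the range of the tangent of
curvature \<open>k\<close>.\<close>

lemma artanh_arg:
  assumes "k < 0" "1 + k * x\<^sup>2 > 0"
  shows "\<bar>sqrt (- k) * x\<bar> < 1"
proof -
  have "(sqrt (-k) * x)\<^sup>2 < 1" using assms by (simp add: power_mult_distrib)
  then show ?thesis by (simp add: abs_square_less_1)
qed

lemma gatan_has_derivative:
  assumes "1 + k * x\<^sup>2 > 0"
  shows "(gatan k has_real_derivative 1 / (1 + k * x\<^sup>2)) (at x)"
proof -
  consider "k > 0" | "k = 0" | "k < 0" by linarith
  then show ?thesis
  proof cases
    case 1
    then show ?thesis unfolding gatan_def
      by (auto intro!: derivative_eq_intros simp: power_mult_distrib inverse_eq_divide)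
  next
    case 2
    then show ?thesis unfolding gatan_def by (auto intro!: derivative_eq_intros)
  next
    case 3
    have "((\<lambda>x. artanh (sqrt (- k) * x)) has_real_derivative
        1 / (1 - (sqrt (- k) * x)\<^sup>2) * sqrt (- k)) (at x)"
      by (rule DERIV_chain2[where f = artanh and g = "\<lambda>x. sqrt (- k) * x", OF artanh_real_has_field_derivative[OF artanh_arg[OF 3 assms]]])
        (auto intro!: derivative_eq_intros)
    from DERIV_cdivide[OF this, of "sqrt (- k)"] show ?thesis
      using 3 unfolding gatan_def by (simp add: power_mult_distrib)
  qed
qed

text \<open>Together with \<open>gatan_gtan\<close>: \<open>gatan k\<close> inverts the tangent \<open>gsin k / gcos k\<close> on \<open>gdom k\<close>. The
equation is written without division.\<close>

lemma gatan_pos: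
  assumes "x > 0" "1 + k * x\<^sup>2 > 0"
  shows "gatan k x \<in> gdom k" "gsin k (gatan k x) = x * gcos k (gatan k x)"
proof -
  have "gatan k x \<in> gdom k \<and> gsin k (gatan k x) = x * gcos k (gatan k x)"
  proof -
    consider "k > 0" | "k = 0" | "k < 0" by linarith
    then show ?thesis
    proof cases
      case 1
      have "cos (arctan (sqrt k * x)) > 0" by (simp add: cos_arctan add_pos_nonneg)
      then have "sin (arctan (sqrt k * x)) = sqrt k * x * cos (arctan (sqrt k * x))"
        using tan_arctan[of "sqrt k * x"] by (simp add: tan_def field_simps)
      with 1 assms(1) arctan_ubound[of "sqrt k * x"] show ?thesis
        by (simp add: gatan_def gdom_def gsin_def gcos_def)
    next
      case 2
      then show ?thesis using assms by (simp add: gatan_def gdom_def gsin_def gcos_def)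
    next
      case 3
      let ?z = "sqrt (- k) * x"
      have z: "\<bar>?z\<bar> < 1" "0 < ?z" using artanh_arg[OF 3 assms(2)] 3 assms(1) by auto
      have "1 < (1 + ?z) / (1 - ?z)" using z by (simp add: field_simps)
      then have "artanh ?z > 0" unfolding artanh_def by simp
      moreover have "tanh (artanh ?z) = ?z"
      proof -
        have "artanh ?z = ln (sqrt ((1 + ?z) / (1 - ?z)))"
          using z by (simp add: artanh_def ln_sqrt)
        then have "tanh (artanh ?z) = ((1 + ?z) / (1 - ?z) - 1) / ((1 + ?z) / (1 - ?z) + 1)"
          using z by (simp add: tanh_ln_real)
        also have "\<dots> = ?z" using z by (simp add: field_simps)
        finally show ?thesis .
      qed
      then have "sinh (artanh ?z) = ?z * cosh (artanh ?z)"
        by (simp add: tanh_def field_simps)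
      ultimately show ?thesis
        using 3 by (simp add: gatan_def gdom_def gsin_def gcos_def)
    qed
  qed
  then show "gatan k x \<in> gdom k" "gsin k (gatan k x) = x * gcos k (gatan k x)" by auto
qed

lemma gatan_mono:
  assumes "0 \<le> x" "x \<le> y" "1 + k * y\<^sup>2 > 0"
  shows "gatan k x \<le> gatan k y"
proof (rule DERIV_nonneg_imp_nondecreasing[OF \<open>x \<le> y\<close>])
  fix z assume z: "x \<le> z" "z \<le> y"
  have "1 + k * z\<^sup>2 > 0"
  proof (cases "k \<ge> 0")
    case False
    have "z\<^sup>2 \<le> y\<^sup>2" using z assms by (intro power_mono) auto
    then have "k * y\<^sup>2 \<le> k * z\<^sup>2" using False by (intro mult_left_mono_neg) auto
    then show ?thesis using assms by linarith
  qed (simp add: add_pos_nonneg)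
  then show "\<exists>y. (gatan k has_real_derivative y) (at z) \<and> 0 \<le> y"
    using gatan_has_derivative by (intro exI[of _ "1 / (1 + k * z\<^sup>2)"]) auto
qed

lemma C_k_on_gatan: "C_k_on j {x. 1 + k * x\<^sup>2 > 0} (gatan k)"
proof (cases j)
  case 0
  then show ?thesis
    using DERIV_isCont[OF gatan_has_derivative] by (auto intro!: continuous_at_imp_continuous_on)
next
  case (Suc i)
  have "open {x. 1 + k * x\<^sup>2 > 0}" by (intro open_Collect_less continuous_intros)
  moreover have "C_k_on i {x. 1 + k * x\<^sup>2 > 0} (\<lambda>x. 1 / (1 + k * (x * x)))"
    using calculation
    by (intro C_k_on_divide C_k_on_add C_k_on_mult C_k_on_const
        C_k_on_bounded_linear[OF bounded_linear_ident]) (auto simp: power2_eq_square)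
  ultimately show ?thesis unfolding Suc
    using gatan_has_derivative by (intro C_k_on_real_SucI) (auto simp: power2_eq_square)
qed

section \<open>Geodesics in null coordinates\<close>

text \<open>Here \<open>u\<close>, \<open>v\<close> are null coordinates vanishing at the initial point and \<open>y = 1 - m u + n v\<close>. An extremal
  satisfies \<open>\<psi>' = n exp \<psi> + m exp (-\<psi>)\<close>, \<open>u' = y exp (-\<psi>)\<close>, \<open>v' = y exp \<psi>\<close>. For \<open>exp \<psi>\<close> this is the Riccati
  equation \<open>W' = n W\<^sup>2 + m\<close>, which the linear system \<open>P' = m Q\<close>, \<open>Q' = - n P\<close> solves by \<open>W = P / Q\<close>.\<close>

definition geoP :: "real \<Rightarrow> real \<Rightarrow> real \<Rightarrow> real \<Rightarrow> real" where
  "geoP m n w t = w * gcos (m * n) t + m * gsin (m * n) t"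

definition geoQ :: "real \<Rightarrow> real \<Rightarrow> real \<Rightarrow> real \<Rightarrow> real" where
  "geoQ m n w t = gcos (m * n) t - n * w * gsin (m * n) t"

lemma geoP_0 [simp]: "geoP m n w 0 = w" and geoQ_0 [simp]: "geoQ m n w 0 = 1"
  by (auto simp: geoP_def geoQ_def)

lemma geoP_has_derivative: "(geoP m n w has_real_derivative m * geoQ m n w t) (at t)"
  unfolding geoP_def geoQ_def
  by (auto intro!: derivative_eq_intros gsin_has_derivative gcos_has_derivative simp: algebra_simps)

lemma geoQ_has_derivative: "(geoQ m n w has_real_derivative - n * geoP m n w t) (at t)"
  unfolding geoP_def geoQ_def
  by (auto intro!: derivative_eq_intros gsin_has_derivative gcos_has_derivative simp: algebra_simps)

lemma isCont_geoP: "isCont (geoP m n w) t" and isCont_geoQ: "isCont (geoQ m n w) t"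
  using geoP_has_derivative geoQ_has_derivative by (blast intro: DERIV_isCont)+

text \<open>The vector \<open>(P, Q)\<close> arises from \<open>(w, 1)\<close> by the fundamental matrix of the linear system, which has
determinant \<open>1\<close>; the two identities apply the inverse matrix. They are the numerators in the
derivatives of \<open>gsin / P\<close> and \<open>gsin / Q\<close>, and show that \<open>P\<close> and \<open>Q\<close> have no common zero.\<close>

lemma geoPQ_wronskian:
  "gcos (m * n) t * geoP m n w t - m * gsin (m * n) t * geoQ m n w t = w"
  "gcos (m * n) t * geoQ m n w t + n * gsin (m * n) t * geoP m n w t = 1"
proof -
  have "gcos (m * n) t * geoP m n w t - m * gsin (m * n) t * geoQ m n w t
     = w * ((gcos (m * n) t)\<^sup>2 + m * n * (gsin (m * n) t)\<^sup>2)"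
    by (simp add: geoP_def geoQ_def algebra_simps power2_eq_square)
  then show "gcos (m * n) t * geoP m n w t - m * gsin (m * n) t * geoQ m n w t = w"
    by (simp add: gcos_gsin_squares)
  have "gcos (m * n) t * geoQ m n w t + n * gsin (m * n) t * geoP m n w t
     = (gcos (m * n) t)\<^sup>2 + m * n * (gsin (m * n) t)\<^sup>2"
    by (simp add: geoP_def geoQ_def algebra_simps power2_eq_square)
  then show "gcos (m * n) t * geoQ m n w t + n * gsin (m * n) t * geoP m n w t = 1"
    by (simp only: gcos_gsin_squares)
qed

text \<open>The height along the extremal \<open>u = gsin / P\<close>, \<open>v = w gsin / Q\<close>.\<close>

lemma geo_height:
  assumes "geoP m n w t \<noteq> 0" "geoQ m n w t \<noteq> 0"
  shows "1 - m * (gsin (m * n) t / geoP m n w t) + n * (w * gsin (m * n) t / geoQ m n w t)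
    = w / (geoP m n w t * geoQ m n w t)"
proof -
  let ?s = "gsin (m * n) t" and ?c = "gcos (m * n) t"
  have "geoP m n w t * geoQ m n w t - m * ?s * geoQ m n w t + n * w * ?s * geoP m n w t
      = w * (?c\<^sup>2 + m * n * ?s\<^sup>2)"
    by (simp add: geoP_def geoQ_def algebra_simps power2_eq_square)
  then have "geoP m n w t * geoQ m n w t - m * ?s * geoQ m n w t + n * w * ?s * geoP m n w t = w"
    by (simp add: gcos_gsin_squares)
  then show ?thesis using assms by (simp add: field_simps)
qed

lemma null_geodesic_derivatives:
  assumes "w > 0" and P: "geoP m n w t > 0" and Q: "geoQ m n w t > 0"
  defines "psi \<equiv> \<lambda>t. ln (geoP m n w t / geoQ m n w t)"
  shows "(psi has_real_derivative n * exp (psi t) + m * exp (- psi t)) (at t)"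
    and "((\<lambda>t. gsin (m * n) t / geoP m n w t) has_real_derivative
          w / (geoP m n w t * geoQ m n w t) * exp (- psi t)) (at t)"
    and "((\<lambda>t. w * gsin (m * n) t / geoQ m n w t) has_real_derivative
          w / (geoP m n w t * geoQ m n w t) * exp (psi t)) (at t)"
proof -
  let ?P = "geoP m n w t" and ?Q = "geoQ m n w t" and ?s = "gsin (m * n) t" and ?c = "gcos (m * n) t"
  have e: "exp (psi t) = ?P / ?Q" "exp (- psi t) = ?Q / ?P"
    using P Q by (auto simp: psi_def exp_minus)
  have "(psi has_real_derivative (m * ?Q * ?Q - ?P * (- n * ?P)) / (?Q * ?Q) * (1 / (?P / ?Q))) (at t)"
    unfolding psi_def
    using P Q by (auto intro!: derivative_eq_intros geoP_has_derivative geoQ_has_derivative)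
  moreover have "(m * ?Q * ?Q - ?P * (- n * ?P)) / (?Q * ?Q) * (1 / (?P / ?Q)) = n * exp (psi t) + m * exp (- psi t)"
    unfolding e using P Q by (simp add: field_simps)
  ultimately show "(psi has_real_derivative n * exp (psi t) + m * exp (- psi t)) (at t)" by simp
  have "((\<lambda>t. gsin (m * n) t / geoP m n w t) has_real_derivative (?c * ?P - ?s * (m * ?Q)) / (?P * ?P)) (at t)"
    using P by (intro DERIV_divide gsin_has_derivative geoP_has_derivative) auto
  moreover have "?c * ?P - ?s * (m * ?Q) = w"
    using geoPQ_wronskian(1)[of m n t w] by (simp add: algebra_simps)
  ultimately show "((\<lambda>t. gsin (m * n) t / geoP m n w t) has_real_derivative w / (?P * ?Q) * exp (- psi t)) (at t)"
    unfolding e using P Q by simp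
  have "((\<lambda>t. w * (gsin (m * n) t / geoQ m n w t)) has_real_derivative w * ((?c * ?Q - ?s * (- n * ?P)) / (?Q * ?Q))) (at t)"
    using Q by (intro DERIV_cmult DERIV_divide gsin_has_derivative geoQ_has_derivative) auto
  moreover have "?c * ?Q - ?s * (- n * ?P) = 1"
    using geoPQ_wronskian(2)[of m n t w] by (simp add: algebra_simps)
  ultimately show "((\<lambda>t. w * gsin (m * n) t / geoQ m n w t) has_real_derivative w / (?P * ?Q) * exp (psi t)) (at t)"
    unfolding e using P Q by simp
qed

text \<open>Uniqueness without a Lipschitz estimate. The defect \<open>R = exp \<psi> \<cdot> Q - P\<close> satisfies a linear
homogeneous equation whose integrating factor can be read off from the solution itself, so \<open>R\<close>
vanishes. As \<open>P\<close> and \<open>Q\<close> have no common zero, \<open>Q\<close> cannot vanish on \<open>I\<close>, and a solution lives only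
where \<open>P\<close> and \<open>Q\<close> are positive. The conserved quantity \<open>y P Q\<close> then determines the height, and
with it \<open>u'\<close> and \<open>v'\<close>.\<close>

lemma null_geodesic_unique:
  fixes psi u v :: "real \<Rightarrow> real"
  assumes I: "is_interval I" "0 \<in> I"
    and w: "w = exp (psi 0)" and init: "u 0 = 0" "v 0 = 0"
    and y: "\<And>t. t \<in> I \<Longrightarrow> 1 - m * u t + n * v t > 0"
    and dpsi: "\<And>t. t \<in> I \<Longrightarrow> (psi has_real_derivative n * exp (psi t) + m * exp (- psi t)) (at t)"
    and du: "\<And>t. t \<in> I \<Longrightarrow> (u has_real_derivative (1 - m * u t + n * v t) * exp (- psi t)) (at t)"
    and dv: "\<And>t. t \<in> I \<Longrightarrow> (v has_real_derivative (1 - m * u t + n * v t) * exp (psi t)) (at t)"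
    and t: "t \<in> I"
  shows "geoP m n w t > 0" "geoQ m n w t > 0" "exp (psi t) = geoP m n w t / geoQ m n w t"
    "u t = gsin (m * n) t / geoP m n w t" "v t = w * gsin (m * n) t / geoQ m n w t"
proof -
  have conv: "convex I" using I(1) by (rule is_interval_convex)
  have const: "f r = f 0" if "r \<in> I" and f: "\<And>t. t \<in> I \<Longrightarrow> (f has_real_derivative 0) (at t)" for f r
  proof -
    obtain c where "\<And>x. x \<in> I \<Longrightarrow> f x = c"
      using has_field_derivative_zero_constant[OF conv, of f] f
      by (metis has_field_derivative_at_within)
    then show ?thesis using that(1) I(2) by metis
  qed
  define y where "y t = 1 - m * u t + n * v t" for t
  have ypos: "y t > 0" if "t \<in> I" for t using y that by (simp add: y_def)
  have dy: "(y has_real_derivative y t * (n * exp (psi t) - m * exp (- psi t))) (at t)" if "t \<in> I" for t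
    unfolding y_def using du[OF that] dv[OF that]
    by (auto intro!: derivative_eq_intros simp: algebra_simps)
  let ?P = "geoP m n w" and ?Q = "geoQ m n w"
  have w0: "w > 0" using w by simp
  (* The defect R vanishes at 0 and solves R' = n exp(psi) R, while y exp(psi) solves
     the linear equation with the doubled coefficient. *)
  define R where "R t = exp (psi t) * ?Q t - ?P t" for t
  have dR: "(R has_real_derivative n * exp (psi t) * R t) (at t)" if "t \<in> I" for t
    unfolding R_def using dpsi[OF that]
    by (auto intro!: derivative_eq_intros geoP_has_derivative geoQ_has_derivative
        simp: algebra_simps exp_minus)
  have quot: "(R r)\<^sup>2 / (y r * exp (psi r)) = (R 0)\<^sup>2 / (y 0 * exp (psi 0))" if "r \<in> I" for r
  proof (rule const[OF that])
    fix t assume t: "t \<in> I"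
    define z where "z t = y t * exp (psi t)" for t
    have "(z has_real_derivative 2 * n * exp (psi t) * z t) (at t)"
      using dpsi[OF t] dy[OF t] unfolding z_def
      by (auto intro!: derivative_eq_intros simp: algebra_simps exp_minus)
    moreover have "((\<lambda>t. (R t)\<^sup>2) has_real_derivative 2 * n * exp (psi t) * (R t)\<^sup>2) (at t)"
      using dR[OF t] by (auto intro!: derivative_eq_intros simp: algebra_simps power2_eq_square)
    moreover have "z t \<noteq> 0" using ypos[OF t] by (simp add: z_def)
    ultimately have "((\<lambda>t. (R t)\<^sup>2 / z t) has_real_derivative
        (2 * n * exp (psi t) * (R t)\<^sup>2 * z t - (R t)\<^sup>2 * (2 * n * exp (psi t) * z t)) / (z t * z t)) (at t)"
      by (intro DERIV_divide)
    then show "((\<lambda>t. (R t)\<^sup>2 / (y t * exp (psi t))) has_real_derivative 0) (at t)"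
      by (simp add: z_def mult.left_commute mult.commute)
  qed
  have "R 0 = 0" using w by (simp add: R_def)
  then have R0: "R r = 0" if "r \<in> I" for r
    using quot[OF that] ypos[OF that] by simp
  have PQ: "?P r = exp (psi r) * ?Q r" if "r \<in> I" for r using R0[OF that] by (simp add: R_def)
  have Qne: "?Q r \<noteq> 0" if "r \<in> I" for r
    using PQ[OF that] geoPQ_wronskian(1)[of m n r w] w0 by auto
  have Qpos: "?Q r > 0" if "r \<in> I" for r
  proof (rule ccontr)
    assume "\<not> ?Q r > 0"
    have "connected (?Q ` I)"
      by (intro connected_continuous_image is_interval_connected I continuous_at_imp_continuous_on ballI isCont_geoQ)
    moreover have "?Q r \<in> ?Q ` I" "1 \<in> ?Q ` I" using that I(2) by (auto intro!: image_eqI[of _ _ 0])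
    ultimately have "0 \<in> ?Q ` I"
      using \<open>\<not> ?Q r > 0\<close> connected_contains_Icc[of "?Q ` I" "?Q r" 1] by auto
    then show False using Qne by auto
  qed
  have Ppos: "?P r > 0" if "r \<in> I" for r using PQ[OF that] Qpos[OF that] by simp
  have epsi: "exp (psi r) = ?P r / ?Q r" if "r \<in> I" for r using PQ[OF that] Qpos[OF that] by simp
  have em: "exp (- psi r) = ?Q r / ?P r" if "r \<in> I" for r
    using epsi[OF that] by (simp add: exp_minus)
  have "y r * (?P r * ?Q r) = y 0 * (?P 0 * ?Q 0)" if "r \<in> I" for r
  proof (rule const[OF that])
    fix t assume t: "t \<in> I"
    show "((\<lambda>t. y t * (?P t * ?Q t)) has_real_derivative 0) (at t)"
      using Ppos[OF t] Qpos[OF t]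
      by (auto intro!: derivative_eq_intros dy[OF t] geoP_has_derivative geoQ_has_derivative
          simp: epsi[OF t] em[OF t] field_simps)
  qed
  then have y': "y r = w / (?P r * ?Q r)" if "r \<in> I" for r
    using that Ppos[OF that] Qpos[OF that] init by (simp add: field_simps y_def)
  have nd: "exp (ln (?P r / ?Q r)) = exp (psi r)" "exp (- ln (?P r / ?Q r)) = exp (- psi r)" if "r \<in> I" for r
    using epsi[OF that] em[OF that] Ppos[OF that] Qpos[OF that] by (auto simp: exp_minus)
  have "u t - gsin (m * n) t / ?P t = u 0 - gsin (m * n) 0 / ?P 0"
  proof (rule const[OF t])
    fix t assume t: "t \<in> I"
    show "((\<lambda>t. u t - gsin (m * n) t / ?P t) has_real_derivative 0) (at t)"
      using DERIV_diff[OF du[OF t] null_geodesic_derivatives(2)[OF w0 Ppos[OF t] Qpos[OF t]]]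
      unfolding nd[OF t] y'[OF t, symmetric] y_def by simp
  qed
  then show "u t = gsin (m * n) t / ?P t" using init by simp
  have "v t - w * gsin (m * n) t / ?Q t = v 0 - w * gsin (m * n) 0 / ?Q 0"
  proof (rule const[OF t])
    fix t assume t: "t \<in> I"
    show "((\<lambda>t. v t - w * gsin (m * n) t / ?Q t) has_real_derivative 0) (at t)"
      using DERIV_diff[OF dv[OF t] null_geodesic_derivatives(3)[OF w0 Ppos[OF t] Qpos[OF t]]]
      unfolding nd[OF t] y'[OF t, symmetric] y_def by simp
  qed
  then show "v t = w * gsin (m * n) t / ?Q t" using init by simp
  show "?P t > 0" "?Q t > 0" "exp (psi t) = ?P t / ?Q t"
    using t Ppos Qpos epsi by auto
qed

section \<open>Null coordinates on the group\<close>

text \<open>The coefficients of the height \<open>y = 1 - m \<xi> + n \<eta>\<close> in null coordinates; see \<open>height_null\<close>.\<close>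

definition par_m :: "real ^ 2 ^ 2 \<Rightarrow> real" where
  "par_m A = (A $ 2 $ 1 + A $ 1 $ 1) / (2 * det A)"

definition par_n :: "real ^ 2 ^ 2 \<Rightarrow> real" where
  "par_n A = (A $ 1 $ 1 - A $ 2 $ 1) / (2 * det A)"

definition xi :: "real ^ 2 ^ 2 \<Rightarrow> real \<times> real \<Rightarrow> real" where
  "xi A q = - lam1 A q"

definition eta :: "real ^ 2 ^ 2 \<Rightarrow> real \<times> real \<Rightarrow> real" where
  "eta A q = lam2 A q"

definition of_null :: "real ^ 2 ^ 2 \<Rightarrow> real \<Rightarrow> real \<Rightarrow> real \<times> real" where
  "of_null A u v =
    (((A $ 2 $ 2 + A $ 1 $ 2) * u + (A $ 2 $ 2 - A $ 1 $ 2) * v) / (2 * det A),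
     1 - par_m A * u + par_n A * v)"

lemma height_null:
  assumes "det A \<noteq> 0"
  shows "snd q = 1 - par_m A * xi A q + par_n A * eta A q"
proof -
  have "2 * det A * (snd q - 1) =
      - (A $ 2 $ 1 + A $ 1 $ 1) * xi A q + (A $ 1 $ 1 - A $ 2 $ 1) * eta A q"
    by (simp add: xi_def eta_def lam1_def lam2_def det_2 algebra_simps)
  then have "snd q - 1 =
      (- (A $ 2 $ 1 + A $ 1 $ 1) * xi A q + (A $ 1 $ 1 - A $ 2 $ 1) * eta A q) / (2 * det A)"
    using assms by (simp add: eq_divide_eq mult.commute)
  also have "\<dots> = - par_m A * xi A q + par_n A * eta A q"
    by (simp add: par_m_def par_n_def add_divide_distrib diff_divide_distrib left_diff_distrib)
  finally show ?thesis by simp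
qed

lemma of_null_inverse:
  assumes "det A \<noteq> 0"
  shows "of_null A (xi A q) (eta A q) = q"
proof -
  have "(A $ 2 $ 2 + A $ 1 $ 2) * xi A q + (A $ 2 $ 2 - A $ 1 $ 2) * eta A q = 2 * det A * fst q"
    by (simp add: xi_def eta_def lam1_def lam2_def det_2 algebra_simps)
  then show ?thesis using assms height_null[OF assms, of q] by (simp add: of_null_def prod_eq_iff)
qed

lemma null_of_null:
  assumes "det A \<noteq> 0"
  shows "xi A (of_null A u v) = u" "eta A (of_null A u v) = v"
proof -
  let ?a = "A $ 1 $ 1" and ?b = "A $ 1 $ 2" and ?c = "A $ 2 $ 1" and ?d = "A $ 2 $ 2"
  have D: "2 * det A * fst (of_null A u v) = (?d + ?b) * u + (?d - ?b) * v"
    "2 * det A * (snd (of_null A u v) - 1) = - (?c + ?a) * u + (?a - ?c) * v"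
    using assms by (simp_all add: of_null_def par_m_def par_n_def field_simps)
  have "2 * det A * xi A (of_null A u v) = - ((?c - ?a) * (2 * det A * fst (of_null A u v))
      + (?d - ?b) * (2 * det A * (snd (of_null A u v) - 1)))"
    by (simp add: xi_def lam1_def algebra_simps)
  also have "\<dots> = 2 * det A * u" unfolding D by (simp add: det_2 algebra_simps)
  finally show "xi A (of_null A u v) = u" using assms by simp
  have "2 * det A * eta A (of_null A u v) = (?c + ?a) * (2 * det A * fst (of_null A u v))
      + (?d + ?b) * (2 * det A * (snd (of_null A u v) - 1))"
    by (simp add: eta_def lam2_def algebra_simps)
  also have "\<dots> = 2 * det A * v" unfolding D by (simp add: det_2 algebra_simps)
  finally show "eta A (of_null A u v) = v" using assms by simp
qed

lemma xi_id [simp]: "xi A aff_id = 0" and eta_id [simp]: "eta A aff_id = 0"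
  by (auto simp: xi_def eta_def lam1_def lam2_def aff_id_def)

lemma of_null_0 [simp]: "of_null A 0 0 = aff_id"
  by (simp add: of_null_def aff_id_def)

lemma vcoords_component:
  "vcoords A q w $ i = (A $ i $ 1 * fst w + A $ i $ 2 * snd w) / snd q"
  by (simp add: vcoords_def frame_coords_def matrix_vector_mult_def sum_2 add_divide_distrib)

text \<open>Up to the sign and the square of the height, the Lorentzian form is the product of the two
differentials.\<close>

lemma null_coordinate_derivatives:
  fixes A :: "real ^ 2 ^ 2"
  assumes q: "(q has_vector_derivative w) (at t)" and "snd (q t) \<noteq> 0"
  defines "z \<equiv> vcoords A (q t) w"
  shows "((\<lambda>t. xi A (q t)) has_real_derivative snd (q t) * (z $ 1 - z $ 2)) (at t)"
    and "((\<lambda>t. eta A (q t)) has_real_derivative snd (q t) * (z $ 1 + z $ 2)) (at t)"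
proof -
  have f: "((\<lambda>t. fst (q t)) has_real_derivative fst w) (at t)"
    using bounded_linear.has_vector_derivative[OF bounded_linear_fst q]
    by (simp add: has_real_derivative_iff_has_vector_derivative)
  have s: "((\<lambda>t. snd (q t)) has_real_derivative snd w) (at t)"
    using bounded_linear.has_vector_derivative[OF bounded_linear_snd q]
    by (simp add: has_real_derivative_iff_has_vector_derivative)
  show "((\<lambda>t. xi A (q t)) has_real_derivative snd (q t) * (z $ 1 - z $ 2)) (at t)"
    unfolding xi_def lam1_def z_def vcoords_component
    using assms(2) by (auto intro!: derivative_eq_intros f s simp: field_simps)
  show "((\<lambda>t. eta A (q t)) has_real_derivative snd (q t) * (z $ 1 + z $ 2)) (at t)"
    unfolding eta_def lam2_def z_def vcoords_component
    using assms(2) by (auto intro!: derivative_eq_intros f s simp: field_simps)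
qed

text \<open>Subtracting \<open>aff_id\<close>, the image of the origin, leaves the linear part of the affine map \<open>of_null\<close>.\<close>

lemma curve_derivative_of_null:
  assumes u: "(u has_real_derivative u') (at t)" and v: "(v has_real_derivative v') (at t)"
  shows "((\<lambda>t. of_null A (u t) (v t)) has_vector_derivative of_null A u' v' - aff_id) (at t)"
proof -
  have eq: "of_null A u' v' - aff_id =
    (((A $ 2 $ 2 + A $ 1 $ 2) * u' + (A $ 2 $ 2 - A $ 1 $ 2) * v') / (2 * det A),
      0 - par_m A * u' + par_n A * v')"
    by (simp add: of_null_def aff_id_def)
  show ?thesis
    unfolding eq unfolding of_null_def
    by (intro has_vector_derivative_Pair; unfold has_real_derivative_iff_has_vector_derivative[symmetric])
      (intro DERIV_cdivide DERIV_add DERIV_diff DERIV_cmult DERIV_const u v)+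
qed

lemma matrix_inv_2:
  fixes A :: "real ^ 2 ^ 2"
  assumes "det A \<noteq> 0"
  shows "matrix_inv A $ 1 $ 1 = A $ 2 $ 2 / det A" "matrix_inv A $ 1 $ 2 = - A $ 1 $ 2 / det A"
    "matrix_inv A $ 2 $ 1 = - A $ 2 $ 1 / det A" "matrix_inv A $ 2 $ 2 = A $ 1 $ 1 / det A"
proof -
  have "\<exists>B. A ** B = mat 1 \<and> B ** A = mat 1"
    using assms invertible_det_nz invertible_def by blast
  then have inv: "A ** matrix_inv A = mat 1"
    unfolding matrix_inv_def by (rule someI2_ex) simp
  have e: "(A ** matrix_inv A) $ i $ j = (mat 1 :: real^2^2) $ i $ j" for i j using inv by simp
  show "matrix_inv A $ 1 $ 1 = A $ 2 $ 2 / det A" "matrix_inv A $ 1 $ 2 = - A $ 1 $ 2 / det A"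
    "matrix_inv A $ 2 $ 1 = - A $ 2 $ 1 / det A" "matrix_inv A $ 2 $ 2 = A $ 1 $ 1 / det A"
    using assms e[of 1 1] e[of 1 2] e[of 2 1] e[of 2 2]
    by (simp_all add: matrix_matrix_mult_def sum_2 mat_def det_2 divide_simps; algebra)+
qed

section \<open>The exponential mapping in closed form\<close>

definition geo :: "real ^ 2 ^ 2 \<Rightarrow> real \<Rightarrow> real \<Rightarrow> real \<times> real" where
  "geo A p t = (let m = par_m A; n = par_n A; w = exp p in
     of_null A (gsin (m * n) t / geoP m n w t) (w * gsin (m * n) t / geoQ m n w t))"

text \<open>The component of \<open>0\<close>, because an extremal ends at the first zero of \<open>P\<close> or \<open>Q\<close>, although both may
become positive again later.\<close>

definition geo_int :: "real ^ 2 ^ 2 \<Rightarrow> real \<Rightarrow> real set" where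
  "geo_int A p = connected_component_set
     {t. geoP (par_m A) (par_n A) (exp p) t > 0 \<and> geoQ (par_m A) (par_n A) (exp p) t > 0} 0"

lemma psi_equation:
  assumes "det A \<noteq> 0"
  shows "matrix_inv A $ 2 $ 2 * cosh p + matrix_inv A $ 2 $ 1 * sinh p
    = par_n A * exp p + par_m A * exp (- p)"
  using assms
  by (simp add: matrix_inv_2 par_m_def par_n_def cosh_def sinh_def field_simps)

lemma extremal_velocity:
  assumes "det A \<noteq> 0"
  shows "cosh p *\<^sub>R Y1 A q + sinh p *\<^sub>R Y2 A q
    = of_null A (snd q * exp (- p)) (snd q * exp p) - aff_id"
  using assms
  by (simp add: Y1_def Y2_def X1_def X2_def matrix_inv_2 par_m_def par_n_def of_null_def aff_id_def
      cosh_def sinh_def field_simps)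

lemma vcoords_extremal_velocity:
  assumes "det A \<noteq> 0" "snd q \<noteq> 0"
  shows "vcoords A q (cosh p *\<^sub>R Y1 A q + sinh p *\<^sub>R Y2 A q) $ 1 = cosh p"
    "vcoords A q (cosh p *\<^sub>R Y1 A q + sinh p *\<^sub>R Y2 A q) $ 2 = sinh p"
proof -
  let ?W = "cosh p *\<^sub>R Y1 A q + sinh p *\<^sub>R Y2 A q"
  have "vcoords A q ?W $ i = (A $ i $ 1 * (A $ 2 $ 2 * cosh p - A $ 1 $ 2 * sinh p)
      + A $ i $ 2 * (- A $ 2 $ 1 * cosh p + A $ 1 $ 1 * sinh p)) / det A" for i
    using assms
    by (simp add: vcoords_component Y1_def Y2_def X1_def X2_def matrix_inv_2 divide_simps)
      (simp add: algebra_simps)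
  moreover have "A $ 1 $ 1 * (A $ 2 $ 2 * cosh p - A $ 1 $ 2 * sinh p)
      + A $ 1 $ 2 * (- A $ 2 $ 1 * cosh p + A $ 1 $ 1 * sinh p) = cosh p * det A"
    "A $ 2 $ 1 * (A $ 2 $ 2 * cosh p - A $ 1 $ 2 * sinh p)
      + A $ 2 $ 2 * (- A $ 2 $ 1 * cosh p + A $ 1 $ 1 * sinh p) = sinh p * det A"
    by (simp_all add: det_2 algebra_simps)
  ultimately show "vcoords A q ?W $ 1 = cosh p" "vcoords A q ?W $ 2 = sinh p"
    using assms by simp_all
qed

text \<open>This transfers the uniqueness of null geodesics to every solution, defined on any interval
around \<open>0\<close>.\<close>

lemma extremal_on_imp_geo:
  assumes A: "det A \<noteq> 0" and ex: "extremal_on A p I psi q" and t: "t \<in> I"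
  shows "geoP (par_m A) (par_n A) (exp p) t > 0" "geoQ (par_m A) (par_n A) (exp p) t > 0"
    "q t = geo A p t"
proof -
  let ?m = "par_m A" and ?n = "par_n A"
  note h = ex[unfolded extremal_on_def]
  have y: "snd (q t) > 0" if "t \<in> I" for t using h that by (auto simp: Aff_def)
  have hq: "1 - ?m * xi A (q t) + ?n * eta A (q t) = snd (q t)" for t
    using height_null[OF A] by simp
  have dq: "(q has_vector_derivative cosh (psi t) *\<^sub>R Y1 A (q t) + sinh (psi t) *\<^sub>R Y2 A (q t)) (at t)"
    if "t \<in> I" for t using h that by blast
  have e: "cosh x - sinh x = exp (- x)" "cosh x + sinh x = exp x" for x :: real
    by (simp_all add: cosh_def sinh_def field_simps)
  have dpsi: "(psi has_real_derivative ?n * exp (psi t) + ?m * exp (- psi t)) (at t)" if "t \<in> I" for t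
    using h that psi_equation[OF A, of "psi t"] by metis
  have dn: "((\<lambda>t. xi A (q t)) has_real_derivative
      (1 - ?m * xi A (q t) + ?n * eta A (q t)) * exp (- psi t)) (at t)"
    "((\<lambda>t. eta A (q t)) has_real_derivative
      (1 - ?m * xi A (q t) + ?n * eta A (q t)) * exp (psi t)) (at t)" if "t \<in> I" for t
    using null_coordinate_derivatives[OF dq[OF that], of A] y[OF that]
    by (simp_all add: vcoords_extremal_velocity[OF A] e hq)
  have init: "exp p = exp (psi 0)" "xi A (q 0) = 0" "eta A (q 0) = 0"
    and I: "is_interval I" "0 \<in> I" using h by auto
  note G = null_geodesic_unique[where m = ?m and n = ?n and u = "\<lambda>t. xi A (q t)"
      and v = "\<lambda>t. eta A (q t)", OF I init _ dpsi dn t, unfolded hq, OF y]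
  show "geoP ?m ?n (exp p) t > 0" "geoQ ?m ?n (exp p) t > 0" using G(1,2) by auto
  have "q t = of_null A (xi A (q t)) (eta A (q t))" using of_null_inverse[OF A] by simp
  then show "q t = geo A p t" unfolding geo_def Let_def using G(4,5) by simp
qed

lemma geo_int_props:
  shows "open (geo_int A p)" "is_interval (geo_int A p)" "0 \<in> geo_int A p"
    and "t \<in> geo_int A p \<Longrightarrow> geoP (par_m A) (par_n A) (exp p) t > 0"
    and "t \<in> geo_int A p \<Longrightarrow> geoQ (par_m A) (par_n A) (exp p) t > 0"
    and "connected S \<Longrightarrow> 0 \<in> S \<Longrightarrow> (\<And>t. t \<in> S \<Longrightarrow>
      geoP (par_m A) (par_n A) (exp p) t > 0 \<and> geoQ (par_m A) (par_n A) (exp p) t > 0) \<Longrightarrow> S \<subseteq> geo_int A p"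
proof -
  let ?S = "{t. geoP (par_m A) (par_n A) (exp p) t > 0 \<and> geoQ (par_m A) (par_n A) (exp p) t > 0}"
  have "open ?S"
    by (intro open_Collect_conj open_Collect_less continuous_at_imp_continuous_on ballI
        isCont_geoP isCont_geoQ continuous_intros)
  then show "open (geo_int A p)" unfolding geo_int_def by (rule open_connected_component)
  show "is_interval (geo_int A p)"
    unfolding geo_int_def by (simp add: is_interval_connected_1)
  show "0 \<in> geo_int A p" unfolding geo_int_def by simp
  have "geo_int A p \<subseteq> ?S" unfolding geo_int_def by (rule connected_component_subset)
  then show "t \<in> geo_int A p \<Longrightarrow> geoP (par_m A) (par_n A) (exp p) t > 0"
    "t \<in> geo_int A p \<Longrightarrow> geoQ (par_m A) (par_n A) (exp p) t > 0" by auto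
  show "connected S \<Longrightarrow> 0 \<in> S \<Longrightarrow> (\<And>t. t \<in> S \<Longrightarrow>
      geoP (par_m A) (par_n A) (exp p) t > 0 \<and> geoQ (par_m A) (par_n A) (exp p) t > 0) \<Longrightarrow> S \<subseteq> geo_int A p"
    unfolding geo_int_def by (rule connected_component_maximal) auto
qed

lemma snd_geo:
  assumes "t \<in> geo_int A p"
  shows "snd (geo A p t) = exp p / (geoP (par_m A) (par_n A) (exp p) t * geoQ (par_m A) (par_n A) (exp p) t)"
  using geo_height[of "par_m A" "par_n A" "exp p" t] geo_int_props(4,5)[OF assms]
  by (simp add: geo_def Let_def of_null_def)

lemma extremal_on_geo:
  assumes A: "det A \<noteq> 0"
  shows "extremal_on A p (geo_int A p)
    (\<lambda>t. ln (geoP (par_m A) (par_n A) (exp p) t / geoQ (par_m A) (par_n A) (exp p) t)) (geo A p)"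
proof -
  let ?m = "par_m A" and ?n = "par_n A" and ?w = "exp p"
  let ?psi = "\<lambda>t. ln (geoP ?m ?n ?w t / geoQ ?m ?n ?w t)"
  have pos: "snd (geo A p t) > 0" if "t \<in> geo_int A p" for t
    using snd_geo[OF that] geo_int_props(4,5)[OF that] by simp
  have "(geo A p has_vector_derivative
      cosh (?psi t) *\<^sub>R Y1 A (geo A p t) + sinh (?psi t) *\<^sub>R Y2 A (geo A p t)) (at t)"
    if t: "t \<in> geo_int A p" for t
    unfolding extremal_velocity[OF A] snd_geo[OF t]
    unfolding geo_def Let_def
    by (intro curve_derivative_of_null null_geodesic_derivatives geo_int_props(4,5)[OF t]) simp_all
  moreover have "(?psi has_real_derivative
      matrix_inv A $ 2 $ 2 * cosh (?psi t) + matrix_inv A $ 2 $ 1 * sinh (?psi t)) (at t)"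
    if t: "t \<in> geo_int A p" for t
    unfolding psi_equation[OF A]
    by (intro null_geodesic_derivatives geo_int_props(4,5)[OF t]) simp
  ultimately show ?thesis
    unfolding extremal_on_def using geo_int_props[where A = A and p = p] pos
    by (auto simp: Aff_def geo_def Let_def)
qed

lemma extremal_interval_subset:
  assumes A: "det A \<noteq> 0" and ex: "extremal_on A p I psi q"
  shows "I \<subseteq> geo_int A p"
proof (rule geo_int_props(6))
  show "connected I" "0 \<in> I" using ex by (auto simp: extremal_on_def is_interval_connected)
qed (use extremal_on_imp_geo[OF A ex] in auto)

lemma max_interval_eq:
  assumes "det A \<noteq> 0"
  shows "max_interval A p = geo_int A p"
  unfolding max_interval_def
  using extremal_interval_subset[OF assms] extremal_on_geo[OF assms, of p] by blast

lemma Exp_eq_geo: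
  assumes A: "det A \<noteq> 0" and t: "t \<in> geo_int A p"
  shows "Exp A (p, t) = geo A p t"
  unfolding Exp_def prod.case
proof (rule the_equality)
  show "\<exists>I psi q. extremal_on A p I psi q \<and> t \<in> I \<and> q t = geo A p t"
    using extremal_on_geo[OF A] t by blast
qed (use extremal_on_imp_geo(3)[OF A] in blast)

text \<open>The maximal interval is open, so its supremum is not attained.\<close>

lemma less_t_max_iff:
  assumes A: "det A \<noteq> 0" and t: "0 < t"
  shows "ereal t < t_max A p \<longleftrightarrow> t \<in> geo_int A p"
proof
  assume "ereal t < t_max A p"
  then obtain r where "r \<in> geo_int A p" "t < r"
    unfolding t_max_def max_interval_eq[OF A] less_SUP_iff by auto
  then show "t \<in> geo_int A p"
    using geo_int_props(2,3)[where A = A and p = p] t mem_is_interval_1_I by (metis less_imp_le)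
next
  assume "t \<in> geo_int A p"
  then obtain e where "e > 0" "ball t e \<subseteq> geo_int A p"
    using geo_int_props(1) open_contains_ball by metis
  then have "t + e / 2 \<in> geo_int A p" by (auto simp: subset_iff dist_real_def)
  then show "ereal t < t_max A p"
    unfolding t_max_def max_interval_eq[OF A] less_SUP_iff using \<open>e > 0\<close>
    by (intro bexI[of _ "t + e / 2"]) auto
qed

lemma N_dom_iff_geo_int:
  assumes "det A \<noteq> 0"
  shows "(p, t) \<in> N_dom A \<longleftrightarrow> 0 < t \<and> t \<in> geo_int A p"
  using less_t_max_iff[OF assms] by (auto simp: N_dom_def)

section \<open>The exponential mapping is a diffeomorphism\<close>

text \<open>The image of the exponential mapping, described by inequalities that do not depend on the sign of
the curvature.\<close>

definition null_region :: "real ^ 2 ^ 2 \<Rightarrow> (real \<times> real) set" where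
  "null_region A = {q. 0 < xi A q \<and> 0 < eta A q \<and> 0 < 1 - par_m A * xi A q \<and>
     0 < 1 + par_n A * eta A q \<and> 0 < snd q}"

text \<open>Null coordinates in which the length element is \<open>sqrt (dX dZ) / (1 + m n X Z)\<close>; the two Moebius
transformations absorb the linear terms of the height, see \<open>conf_height\<close>.\<close>

definition conf_x :: "real ^ 2 ^ 2 \<Rightarrow> real \<times> real \<Rightarrow> real" where
  "conf_x A q = xi A q / (1 - par_m A * xi A q)"

definition conf_z :: "real ^ 2 ^ 2 \<Rightarrow> real \<times> real \<Rightarrow> real" where
  "conf_z A q = eta A q / (1 + par_n A * eta A q)"

text \<open>The candidate for the inverse of the exponential mapping: with \<open>T\<close> the tangent of curvature \<open>m n\<close> at
time \<open>t\<close>, the extremal has \<open>X = T exp (-\<psi>\<^sub>0)\<close> and \<open>Z = T exp \<psi>\<^sub>0\<close>.\<close>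

definition Log :: "real ^ 2 ^ 2 \<Rightarrow> real \<times> real \<Rightarrow> real \<times> real" where
  "Log A q = (ln (conf_z A q / conf_x A q) / 2,
     gatan (par_m A * par_n A) (sqrt (conf_x A q * conf_z A q)))"

lemma conf_height:
  assumes "det A \<noteq> 0" "1 - par_m A * xi A q \<noteq> 0" "1 + par_n A * eta A q \<noteq> 0"
  shows "snd q = (1 + par_m A * par_n A * (conf_x A q * conf_z A q))
    * ((1 - par_m A * xi A q) * (1 + par_n A * eta A q))"
  using assms(2,3) unfolding height_null[OF assms(1)] conf_x_def conf_z_def
  by (simp add: divide_simps) (simp add: algebra_simps)

lemma conf_pos:
  assumes "det A \<noteq> 0" and q: "q \<in> null_region A"
  shows "conf_x A q > 0" "conf_z A q > 0" "1 + par_m A * par_n A * (conf_x A q * conf_z A q) > 0"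
proof -
  have h: "0 < xi A q" "0 < eta A q" "0 < 1 - par_m A * xi A q" "0 < 1 + par_n A * eta A q" "0 < snd q"
    using q by (auto simp: null_region_def)
  then show "conf_x A q > 0" "conf_z A q > 0" by (auto simp: conf_x_def conf_z_def)
  have "0 < (1 - par_m A * xi A q) * (1 + par_n A * eta A q)" using h by simp
  then show "1 + par_m A * par_n A * (conf_x A q * conf_z A q) > 0"
    using conf_height[OF assms(1), of q] h by (metis less_irrefl zero_less_mult_pos2)
qed

lemma par_sum_nonneg: "det A > 0 \<Longrightarrow> A $ 1 $ 1 \<ge> 0 \<Longrightarrow> par_m A + par_n A \<ge> 0"
  by (simp add: par_m_def par_n_def field_simps)

text \<open>Divided by \<open>gcos\<close>, both functions are affine in the tangent, which increases from \<open>0\<close>. As they are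
positive at the tangent values \<open>0\<close> and \<open>T t\<close>, they are positive between. Thus a condition at the
single time \<open>t\<close> decides whether the extremal exists up to \<open>t\<close>.\<close>

lemma geoPQ_pos_before:
  assumes "w > 0" "t \<in> gdom (m * n)" "geoP m n w t > 0" "geoQ m n w t > 0" "0 \<le> r" "r \<le> t"
  shows "geoP m n w r > 0 \<and> geoQ m n w r > 0"
proof (cases "r = 0")
  case True
  then show ?thesis using assms by simp
next
  case False
  define T where "T r = gsin (m * n) r / gcos (m * n) r" for r
  have r: "r \<in> gdom (m * n)" using gdom_downward[OF assms(2)] False assms by auto
  have pos: "0 < T r" "T r \<le> T t"
    using gsin_gcos_pos[OF r] gtan_mono[OF assms(2), of r] False assms by (auto simp: T_def)
  have PQ: "geoP m n w r = gcos (m * n) r * (w + m * T r)"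
    "geoQ m n w r = gcos (m * n) r * (1 - n * w * T r)" if "r \<in> gdom (m * n)" for r
    using gsin_gcos_pos[OF that] by (simp_all add: geoP_def geoQ_def T_def field_simps)
  have t: "w + m * T t > 0" "1 - n * w * T t > 0"
    using assms(3,4) gsin_gcos_pos[OF assms(2)] by (auto simp: PQ[OF assms(2)] zero_less_mult_iff)
  have "w + m * T r > 0"
  proof (cases "m \<ge> 0")
    case True
    then show ?thesis using pos assms(1) by (intro add_pos_nonneg) auto
  next
    case False
    then have "m * T t \<le> m * T r" using pos by (intro mult_left_mono_neg) auto
    then show ?thesis using t by linarith
  qed
  moreover have "1 - n * w * T r > 0"
  proof (cases "n \<ge> 0")
    case True
    then have "n * w * T r \<le> n * w * T t" using pos assms(1) by (intro mult_left_mono) auto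
    then show ?thesis using t by linarith
  next
    case False
    then have "n * w * T r \<le> 0" using pos assms(1) by (simp add: mult_nonpos_nonneg)
    then show ?thesis by linarith
  qed
  ultimately show ?thesis using gsin_gcos_pos[OF r] by (simp add: PQ[OF r])
qed

text \<open>Here \<open>a \<ge> 0\<close> enters. For negative curvature it makes \<open>m\<close> and \<open>n\<close> positive, so at the first zero of
\<open>gcos\<close> the function \<open>Q = - n w gsin\<close> is already negative: the extremal has run off to infinity
before the tangent becomes infinite.\<close>

lemma geo_int_subset_gdom:
  assumes "par_m A + par_n A \<ge> 0" and t: "t \<in> geo_int A p" "0 < t"
  shows "t \<in> gdom (par_m A * par_n A)"
proof (rule ccontr)
  let ?m = "par_m A" and ?n = "par_n A"
  assume "t \<notin> gdom (?m * ?n)"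
  then have k: "?m * ?n > 0" and ge: "pi / 2 \<le> sqrt (?m * ?n) * t"
    using t(2) by (auto simp: gdom_def)
  define r where "r = pi / 2 / sqrt (?m * ?n)"
  have r: "0 \<le> r" "r \<le> t" "sqrt (?m * ?n) * r = pi / 2"
    using k ge by (auto simp: r_def field_simps)
  then have "r \<in> geo_int A p"
    using geo_int_props(2,3)[where A = A and p = p] t(1) mem_is_interval_1_I by metis
  then have "geoQ ?m ?n (exp p) r > 0" by (rule geo_int_props(5))
  moreover have "geoQ ?m ?n (exp p) r = - ?n * exp p / sqrt (?m * ?n)"
    unfolding geoQ_def gcos_def gsin_def r(3) using k by simp
  moreover have "?n > 0" using k assms(1) by (auto simp: zero_less_mult_iff)
  then have "- ?n * exp p / sqrt (?m * ?n) \<le> 0" using k by (simp add: divide_nonpos_pos)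
  ultimately show False by linarith
qed

lemma N_dom_iff:
  assumes "det A \<noteq> 0" "par_m A + par_n A \<ge> 0"
  shows "(p, t) \<in> N_dom A \<longleftrightarrow> t \<in> gdom (par_m A * par_n A) \<and>
    geoP (par_m A) (par_n A) (exp p) t > 0 \<and> geoQ (par_m A) (par_n A) (exp p) t > 0"
proof
  assume "(p, t) \<in> N_dom A"
  then have "0 < t" "t \<in> geo_int A p" using N_dom_iff_geo_int[OF assms(1)] by auto
  then show "t \<in> gdom (par_m A * par_n A) \<and>
    geoP (par_m A) (par_n A) (exp p) t > 0 \<and> geoQ (par_m A) (par_n A) (exp p) t > 0"
    using geo_int_subset_gdom[OF assms(2)] geo_int_props(4,5) by blast
next
  assume h: "t \<in> gdom (par_m A * par_n A) \<and>
    geoP (par_m A) (par_n A) (exp p) t > 0 \<and> geoQ (par_m A) (par_n A) (exp p) t > 0"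
  then have "0 < t" by (simp add: gdom_def)
  moreover have "{0..t} \<subseteq> geo_int A p"
    by (rule geo_int_props(6))
      (use geoPQ_pos_before[of "exp p" t "par_m A" "par_n A"] h \<open>0 < t\<close> in auto)
  ultimately show "(p, t) \<in> N_dom A" using N_dom_iff_geo_int[OF assms(1)] by auto
qed

lemma null_geo:
  assumes "det A \<noteq> 0"
  shows "xi A (geo A p t) = gsin (par_m A * par_n A) t / geoP (par_m A) (par_n A) (exp p) t"
    "eta A (geo A p t) = exp p * gsin (par_m A * par_n A) t / geoQ (par_m A) (par_n A) (exp p) t"
  using null_of_null[OF assms] by (simp_all add: geo_def Let_def)

lemma geo_in_null_region:
  assumes A: "det A \<noteq> 0" "par_m A + par_n A \<ge> 0" and N: "(p, t) \<in> N_dom A"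
  shows "geo A p t \<in> null_region A" "Log A (geo A p t) = (p, t)"
proof -
  let ?m = "par_m A" and ?n = "par_n A" and ?w = "exp p"
  let ?k = "?m * ?n" and ?P = "geoP (par_m A) (par_n A) (exp p) t" and ?Q = "geoQ (par_m A) (par_n A) (exp p) t"
  let ?s = "gsin ?k t" and ?c = "gcos ?k t"
  have t: "t \<in> gdom ?k" "?P > 0" "?Q > 0" using N N_dom_iff[OF A] by auto
  have sc: "?s > 0" "?c > 0" using gsin_gcos_pos t by auto
  have u: "1 - ?m * (?s / ?P) = ?w * ?c / ?P" and v: "1 + ?n * (?w * ?s / ?Q) = ?c / ?Q"
    using t by (simp_all add: field_simps) (simp_all add: geoP_def geoQ_def algebra_simps)
  have "t \<in> geo_int A p" using N N_dom_iff_geo_int[OF A(1)] by auto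
  then have "snd (geo A p t) > 0" using snd_geo t by simp
  then show "geo A p t \<in> null_region A"
    unfolding null_region_def mem_Collect_eq null_geo[OF A(1)] u v using t sc by simp
  have X: "conf_x A (geo A p t) = ?s / ?c / ?w"
    unfolding conf_x_def null_geo[OF A(1)] u using t sc by (simp add: field_simps)
  have Z: "conf_z A (geo A p t) = ?s / ?c * ?w"
    unfolding conf_z_def null_geo[OF A(1)] v using t sc by (simp add: field_simps)
  have XZ: "conf_x A (geo A p t) * conf_z A (geo A p t) = (?s / ?c)\<^sup>2"
    unfolding X Z by (simp add: power2_eq_square)
  have "conf_z A (geo A p t) / conf_x A (geo A p t) = exp (2 * p)"
    unfolding X Z using sc by (simp add: exp_double power2_eq_square)
  then show "Log A (geo A p t) = (p, t)"
    unfolding Log_def XZ using sc gatan_gtan[OF t(1)] by simp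
qed

text \<open>From \<open>T = sqrt (X Z)\<close> and \<open>w = sqrt (Z / X)\<close> one recovers \<open>X = T / w\<close> and \<open>Z = w T\<close>. In these terms
\<open>P\<close> and \<open>Q\<close> at time \<open>t\<close> are \<open>gcos \<cdot> w / (1 - m \<xi>)\<close> and \<open>gcos / (1 + n \<eta>)\<close>, hence positive, and the height
being positive is what puts \<open>T\<close> into the range of the tangent.\<close>

lemma Log_in_N_dom:
  assumes A: "det A \<noteq> 0" "par_m A + par_n A \<ge> 0" and q: "q \<in> null_region A"
  shows "Log A q \<in> N_dom A" "geo A (fst (Log A q)) (snd (Log A q)) = q"
proof -
  let ?m = "par_m A" and ?n = "par_n A" and ?u = "xi A q" and ?v = "eta A q"
  define X where "X = conf_x A q"
  define Z where "Z = conf_z A q"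
  define w where "w = exp (ln (Z / X) / 2)"
  define T where "T = sqrt (X * Z)"
  define t where "t = gatan (?m * ?n) T"
  have h: "0 < ?u" "0 < ?v" "0 < 1 - ?m * ?u" "0 < 1 + ?n * ?v" "0 < snd q"
    using q by (auto simp: null_region_def)
  have pos: "X > 0" "Z > 0" using conf_pos[OF A(1) q] by (auto simp: X_def Z_def)
  have w: "w > 0" "w\<^sup>2 = Z / X"
    using pos by (auto simp: w_def power2_eq_square simp flip: exp_add)
  have T: "T > 0" "T\<^sup>2 = X * Z" using pos by (auto simp: T_def)
  have "(w * T)\<^sup>2 = Z\<^sup>2" using pos by (simp add: power_mult_distrib w T) (simp add: power2_eq_square)
  then have wT: "w * T = Z" using w T pos by (simp add: power2_eq_iff_nonneg)
  then have Tw: "T = w * X"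
  proof -
    have "w * T = w * (w * X)" using wT w(2) pos by (simp add: power2_eq_square field_simps)
    then show ?thesis using w by simp
  qed
  have "0 < 1 + ?m * ?n * (X * Z)"
    using conf_pos(3)[OF A(1) q] unfolding X_def Z_def .
  then have t: "t \<in> gdom (?m * ?n)" "gsin (?m * ?n) t = T * gcos (?m * ?n) t"
    using gatan_pos[OF T(1), of "?m * ?n"] by (auto simp: T t_def)
  let ?c = "gcos (?m * ?n) t"
  have c: "?c > 0" using gsin_gcos_pos t(1) by blast
  have X: "1 + ?m * X = 1 / (1 - ?m * ?u)" and Z: "1 - ?n * Z = 1 / (1 + ?n * ?v)"
    using h by (auto simp: X_def Z_def conf_x_def conf_z_def field_simps)
  have "geoP ?m ?n w t = ?c * w * (1 + ?m * X)"
    by (simp add: geoP_def t(2) Tw algebra_simps)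
  then have P: "geoP ?m ?n w t = ?c * w / (1 - ?m * ?u)" using X by simp
  have "geoQ ?m ?n w t = ?c * (1 - ?n * Z)"
    by (simp add: geoQ_def t(2) wT[symmetric] algebra_simps)
  then have Q: "geoQ ?m ?n w t = ?c / (1 + ?n * ?v)" using Z by simp
  have L: "Log A q = (ln (Z / X) / 2, t)"
    by (simp add: Log_def X_def Z_def t_def T_def)
  show "Log A q \<in> N_dom A"
    unfolding L N_dom_iff[OF A] using t c h w P Q by (simp add: w_def[symmetric])
  have "gsin (?m * ?n) t / geoP ?m ?n w t = X * (1 - ?m * ?u)"
    unfolding P t(2) Tw using c w h by (simp add: field_simps)
  also have "\<dots> = ?u" using h by (simp add: X_def conf_x_def)
  finally have 1: "gsin (?m * ?n) t / geoP ?m ?n w t = ?u" .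
  have "w * gsin (?m * ?n) t / geoQ ?m ?n w t = (w * T) * (1 + ?n * ?v)"
    unfolding Q t(2) using c w h by (simp add: field_simps)
  also have "\<dots> = ?v" unfolding wT using h by (simp add: Z_def conf_z_def)
  finally have 2: "w * gsin (?m * ?n) t / geoQ ?m ?n w t = ?v" .
  show "geo A (fst (Log A q)) (snd (Log A q)) = q"
    unfolding L geo_def Let_def using 1 2 of_null_inverse[OF A(1), of q] by (simp add: w_def[symmetric])
qed

lemma C_k_on_fst: "C_k_on k S fst" and C_k_on_snd: "C_k_on k S snd"
  by (intro C_k_on_bounded_linear bounded_linear_fst bounded_linear_snd)+

lemma continuous_on_null:
  "continuous_on S (xi A)" "continuous_on S (eta A)"
  unfolding xi_def eta_def lam1_def lam2_def by (intro continuous_intros)+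

lemma open_null_region: "open (null_region A)"
  unfolding null_region_def
  by (intro open_Collect_conj open_Collect_less continuous_intros continuous_on_null)

lemma C_k_on_null:
  assumes "open S"
  shows "C_k_on k S (xi A)" "C_k_on k S (eta A)"
proof -
  have "C_k_on k S (\<lambda>q. (A $ 1 $ 1 - A $ 2 $ 1) * fst q + (A $ 1 $ 2 - A $ 2 $ 2) * (snd q - 1))"
    "C_k_on k S (eta A)"
    unfolding eta_def lam2_def
    by (intro C_k_on_add C_k_on_diff C_k_on_mult C_k_on_const C_k_on_fst C_k_on_snd assms)+
  moreover have "(\<lambda>q. (A $ 1 $ 1 - A $ 2 $ 1) * fst q + (A $ 1 $ 2 - A $ 2 $ 2) * (snd q - 1)) = xi A"
    by (simp add: xi_def lam1_def fun_eq_iff algebra_simps)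
  ultimately show "C_k_on k S (xi A)" "C_k_on k S (eta A)" by auto
qed

lemma C_k_on_Log:
  assumes "det A \<noteq> 0"
  shows "C_k_on k (null_region A) (Log A)"
proof -
  let ?S = "null_region A" and ?k = "par_m A * par_n A"
  note S = open_null_region[of A]
  have pos: "conf_x A q > 0" "conf_z A q > 0" "1 + ?k * (conf_x A q * conf_z A q) > 0" if "q \<in> ?S" for q
    using conf_pos[OF assms that] .
  have sq: "(sqrt (conf_x A q * conf_z A q))\<^sup>2 = conf_x A q * conf_z A q" if "q \<in> ?S" for q
    using pos(1,2)[OF that] by simp
  have xz: "C_k_on k ?S (conf_x A)" "C_k_on k ?S (conf_z A)"
    unfolding conf_x_def conf_z_def
    by (intro C_k_on_divide C_k_on_add C_k_on_diff C_k_on_mult C_k_on_const C_k_on_null S;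
        auto simp: null_region_def)+
  show ?thesis
    unfolding Log_def
    by (intro C_k_on_Pair C_k_on_divide C_k_on_const C_k_on_mult xz S
        C_k_on_compose_real[OF S _ _ C_k_on_ln] C_k_on_compose_real[OF S _ _ C_k_on_sqrt]
        C_k_on_compose_real[OF S _ _ C_k_on_gatan[of k ?k]])
      (use pos in \<open>auto simp: less_imp_neq[symmetric] sq\<close>)
qed

lemma C_k_on_geoPQ:
  assumes S: "open S"
  shows "C_k_on k S (\<lambda>x. geoP m n (exp (fst x)) (snd x))"
    "C_k_on k S (\<lambda>x. geoQ m n (exp (fst x)) (snd x))"
    "C_k_on k S (\<lambda>x. gsin (m * n) (snd x))"
    "C_k_on k S (\<lambda>x. exp (fst x))"
  unfolding geoP_def geoQ_def
  by (intro C_k_on_add C_k_on_diff C_k_on_mult C_k_on_const S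
      C_k_on_compose_real[OF S _ C_k_on_fst C_k_on_exp]
      C_k_on_compose_real[OF S _ C_k_on_snd conjunct1[OF C_k_on_gsin_gcos]]
      C_k_on_compose_real[OF S _ C_k_on_snd conjunct2[OF C_k_on_gsin_gcos]]; simp)+

lemma open_N_dom:
  assumes A: "det A \<noteq> 0" "par_m A + par_n A \<ge> 0"
  shows "open (N_dom A)"
proof -
  have eq: "N_dom A = (UNIV \<times> gdom (par_m A * par_n A))
     \<inter> {x. 0 < geoP (par_m A) (par_n A) (exp (fst x)) (snd x)}
     \<inter> {x. 0 < geoQ (par_m A) (par_n A) (exp (fst x)) (snd x)}"
    using N_dom_iff[OF A] by auto
  have "continuous_on UNIV (\<lambda>x. geoP (par_m A) (par_n A) (exp (fst x)) (snd x))"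
    "continuous_on UNIV (\<lambda>x. geoQ (par_m A) (par_n A) (exp (fst x)) (snd x))"
    using C_k_on_geoPQ(1,2)[where k = 0] by auto
  then show ?thesis
    unfolding eq by (intro open_Int open_Times open_Collect_less open_gdom) auto
qed

lemma C_k_on_Exp:
  assumes A: "det A \<noteq> 0" "par_m A + par_n A \<ge> 0"
  shows "C_k_on k (N_dom A) (Exp A)"
proof (rule C_k_on_cong[OF open_N_dom[OF A]])
  show "geo A (fst x) (snd x) = Exp A x" if "x \<in> N_dom A" for x
    using that N_dom_iff_geo_int[OF A(1), of "fst x" "snd x"] Exp_eq_geo[OF A(1), of "snd x" "fst x"] by simp
  note S = open_N_dom[OF A]
  have ne: "geoP (par_m A) (par_n A) (exp (fst x)) (snd x) \<noteq> 0"
    "geoQ (par_m A) (par_n A) (exp (fst x)) (snd x) \<noteq> 0" if "x \<in> N_dom A" for x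
    using that N_dom_iff[OF A, of "fst x" "snd x"] by auto
  show "C_k_on k (N_dom A) (\<lambda>x. geo A (fst x) (snd x))"
    unfolding geo_def Let_def of_null_def
    by (intro C_k_on_Pair C_k_on_divide C_k_on_add C_k_on_diff C_k_on_mult C_k_on_const
        C_k_on_geoPQ S ne) (use A in auto)
qed

lemma diffeomorphism_Exp:
  assumes A: "det A \<noteq> 0" "par_m A + par_n A \<ge> 0"
  shows "diffeomorphism_between (N_dom A) (null_region A) (Exp A)"
proof -
  have E: "Exp A x = geo A (fst x) (snd x)" if "x \<in> N_dom A" for x
    using that N_dom_iff_geo_int[OF A(1), of "fst x" "snd x"] Exp_eq_geo[OF A(1), of "snd x" "fst x"] by simp
  have cE: "continuous_on (N_dom A) (Exp A)" using C_k_on_Exp[OF A, of 0] by simp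
  have cL: "continuous_on (null_region A) (Log A)" using C_k_on_Log[OF A(1), of 0] by simp
  have "homeomorphism (N_dom A) (null_region A) (Exp A) (Log A)"
  proof (rule homeomorphismI[OF cE cL])
    show "Exp A ` N_dom A \<subseteq> null_region A"
      using E geo_in_null_region(1)[OF A] by force
    show "Log A ` null_region A \<subseteq> N_dom A"
      using Log_in_N_dom(1)[OF A] by blast
    show "Log A (Exp A x) = x" if "x \<in> N_dom A" for x
      using E[OF that] geo_in_null_region(2)[OF A, of "fst x" "snd x"] that by simp
    show "Exp A (Log A q) = q" if "q \<in> null_region A" for q
      using E Log_in_N_dom[OF A that] by simp
  qed
  then show ?thesis
    unfolding diffeomorphism_between_def
    using open_N_dom[OF A] open_null_region C_k_on_Exp[OF A] C_k_on_Log[OF A(1)] by blast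
qed

section \<open>Null coordinates along causal curves\<close>

lemma xi_inner: "xi A q = (A $ 1 $ 1 - A $ 2 $ 1, A $ 1 $ 2 - A $ 2 $ 2) \<bullet> q - (A $ 1 $ 2 - A $ 2 $ 2)"
  by (cases q) (simp add: xi_def lam1_def inner_Pair algebra_simps)

lemma eta_inner: "eta A q = (A $ 2 $ 1 + A $ 1 $ 1, A $ 2 $ 2 + A $ 1 $ 2) \<bullet> q - (A $ 2 $ 2 + A $ 1 $ 2)"
  by (cases q) (simp add: eta_def lam2_def inner_Pair algebra_simps)

lemma lipschitz_on_inner_minus:
  fixes v :: "'a::real_inner"
  assumes "L-lipschitz_on S q"
  shows "(norm v * L)-lipschitz_on S (\<lambda>t. v \<bullet> q t - b)"
proof (rule lipschitz_onI)
  fix x y assume "x \<in> S" "y \<in> S"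
  have "dist (v \<bullet> q x - b) (v \<bullet> q y - b) = \<bar>v \<bullet> (q x - q y)\<bar>"
    by (simp add: dist_real_def inner_diff_right)
  also have "\<dots> \<le> norm v * dist (q x) (q y)" by (simp add: Cauchy_Schwarz_ineq2 dist_norm)
  also have "\<dots> \<le> norm v * (L * dist x y)"
    using lipschitz_onD[OF assms \<open>x \<in> S\<close> \<open>y \<in> S\<close>] by (intro mult_left_mono) auto
  finally show "dist (v \<bullet> q x - b) (v \<bullet> q y - b) \<le> norm v * L * dist x y" by simp
qed (use lipschitz_on_nonneg[OF assms] in simp)

text \<open>Along a future directed nonspacelike curve both null coordinates have nonnegative derivative almost
everywhere, and they are Lipschitz, being affine functions on the plane.\<close>

lemma causal_curve_mono_null:
  assumes "causal_curve A s t q"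
  shows "mono_on {s..t} (\<lambda>r. xi A (q r))" "mono_on {s..t} (\<lambda>r. eta A (q r))"
proof -
  obtain L where L: "L-lipschitz_on {s..t} q" using assms by (auto simp: causal_curve_def)
  have ae: "AE r in lebesgue. r \<in> {s..t} \<longrightarrow> q differentiable (at r) \<and>
      future_nonspacelike A (q r) (vector_derivative q (at r))"
    and y: "\<And>r. r \<in> {s..t} \<Longrightarrow> snd (q r) > 0"
    using assms by (auto simp: causal_curve_def Aff_def image_subset_iff)
  have der: "(\<exists>D\<ge>0. ((\<lambda>r. xi A (q r)) has_real_derivative D) (at r)) \<and>
      (\<exists>D\<ge>0. ((\<lambda>r. eta A (q r)) has_real_derivative D) (at r))"
    if "r \<in> {s..t}" "q differentiable (at r) \<and>
      future_nonspacelike A (q r) (vector_derivative q (at r))" for r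
  proof -
    have d: "(q has_vector_derivative vector_derivative q (at r)) (at r)"
      using that(2) vector_derivative_works by blast
    have "snd (q r) \<noteq> 0" using y[OF that(1)] by simp
    note D = null_coordinate_derivatives[OF d this, of A]
    have "0 \<le> snd (q r) * (vcoords A (q r) (vector_derivative q (at r)) $ 1
        - vcoords A (q r) (vector_derivative q (at r)) $ 2)"
      "0 \<le> snd (q r) * (vcoords A (q r) (vector_derivative q (at r)) $ 1
        + vcoords A (q r) (vector_derivative q (at r)) $ 2)"
      using that(2) y[OF that(1)] by (auto simp: future_nonspacelike_def)
    then show ?thesis using D by blast
  qed
  show "mono_on {s..t} (\<lambda>r. xi A (q r))"
  proof (rule lipschitz_nonneg_derivative_mono)
    show "AE r in lebesgue. r \<in> {s..t} \<longrightarrow> (\<exists>D\<ge>0. ((\<lambda>r. xi A (q r)) has_real_derivative D) (at r))"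
      using ae by eventually_elim (use der in blast)
  qed (use lipschitz_on_inner_minus[OF L] in \<open>simp add: xi_inner\<close>)
  show "mono_on {s..t} (\<lambda>r. eta A (q r))"
  proof (rule lipschitz_nonneg_derivative_mono)
    show "AE r in lebesgue. r \<in> {s..t} \<longrightarrow> (\<exists>D\<ge>0. ((\<lambda>r. eta A (q r)) has_real_derivative D) (at r))"
      using ae by eventually_elim (use der in blast)
  qed (use lipschitz_on_inner_minus[OF L] in \<open>simp add: eta_inner\<close>)
qed

section \<open>The image of the exponential mapping\<close>

text \<open>Monotonicity of the null coordinates gives one inclusion; conversely, the segment from the identity
to a point with nonnegative null coordinates is nonspacelike, and it stays in the half-plane by convexity.\<close>

lemma J_plus_eq:
  "J_plus A = {q. 0 \<le> xi A q \<and> 0 \<le> eta A q \<and> 0 < snd q}"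
proof (intro equalityI subsetI)
  fix q1 assume "q1 \<in> J_plus A"
  then obtain s t q where c: "causal_curve A s t q" and e: "q s = aff_id" "q t = q1"
    by (auto simp: J_plus_def)
  then have st: "s \<in> {s..t}" "t \<in> {s..t}" "s \<le> t" by (auto simp: causal_curve_def)
  have "q t \<in> Aff" using c st by (auto simp: causal_curve_def)
  moreover have "xi A (q s) \<le> xi A (q t)" "eta A (q s) \<le> eta A (q t)"
    using causal_curve_mono_null[OF c] st by (auto dest: mono_onD)
  ultimately show "q1 \<in> {q. 0 \<le> xi A q \<and> 0 \<le> eta A q \<and> 0 < snd q}"
    using e by (simp add: Aff_def)
next
  fix q1 assume "q1 \<in> {q. 0 \<le> xi A q \<and> 0 \<le> eta A q \<and> 0 < snd q}"
  then have q1: "0 \<le> xi A q1" "0 \<le> eta A q1" "0 < snd q1" by auto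
  define w where "w = q1 - aff_id"
  define q where "q t = aff_id + t *\<^sub>R w" for t
  have d: "(q has_vector_derivative w) (at t)" for t
    unfolding q_def by (auto intro!: derivative_eq_intros)
  have y: "snd (q t) > 0" if "t \<in> {0..1}" for t
  proof -
    have "snd (q t) = (1 - t) + t * snd q1" by (simp add: q_def w_def aff_id_def algebra_simps)
    moreover have "0 \<le> (1 - t) * (1 - min 1 (snd q1))" "0 \<le> t * (snd q1 - min 1 (snd q1))"
      "0 < min 1 (snd q1)"
      using that q1(3) by auto
    ultimately show ?thesis by (simp add: algebra_simps)
  qed
  have v: "vcoords A (q t) w $ 1 - vcoords A (q t) w $ 2 = xi A q1 / snd (q t)"
    "vcoords A (q t) w $ 1 + vcoords A (q t) w $ 2 = eta A q1 / snd (q t)" for t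
    by (simp_all add: vcoords_component w_def aff_id_def xi_def eta_def lam1_def lam2_def
        add_divide_distrib[symmetric] diff_divide_distrib[symmetric])
      (simp_all add: algebra_simps)
  have fut: "future_nonspacelike A (q t) (vector_derivative q (at t))" if "t \<in> {0..1}" for t
  proof -
    have "0 \<le> xi A q1 / snd (q t)" "0 \<le> eta A q1 / snd (q t)"
      using q1 y[OF that] by (auto intro: divide_nonneg_pos)
    then show ?thesis
      unfolding future_nonspacelike_def vector_derivative_at[OF d] v[symmetric] by linarith
  qed
  have "(norm w)-lipschitz_on {0..1} q"
    by (rule lipschitz_onI)
      (auto simp: q_def dist_norm norm_scaleR[symmetric] scaleR_left_diff_distrib[symmetric] mult.commute)
  moreover have "q ` {0..1} \<subseteq> Aff" using y by (auto simp: Aff_def)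
  moreover have "q differentiable (at t)" for t
    using d has_vector_derivative_def differentiable_def by blast
  ultimately have "causal_curve A 0 1 q"
    unfolding causal_curve_def using fut by auto
  moreover have "q 0 = aff_id" "q 1 = q1" by (simp_all add: q_def w_def)
  ultimately show "q1 \<in> J_plus A" unfolding J_plus_def by blast
qed

text \<open>Since \<open>A\<close> is invertible, \<open>\<xi>\<close> and \<open>\<eta>\<close> are nonconstant, so these are genuine half-planes.\<close>

lemma interior_null_ge:
  assumes "det A \<noteq> 0"
  shows "interior {q. 0 \<le> xi A q} = {q. 0 < xi A q}" "interior {q. 0 \<le> eta A q} = {q. 0 < eta A q}"
proof -
  let ?v = "(A $ 1 $ 1 - A $ 2 $ 1, A $ 1 $ 2 - A $ 2 $ 2)" and ?w = "(A $ 2 $ 1 + A $ 1 $ 1, A $ 2 $ 2 + A $ 1 $ 2)"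
  have "?v \<noteq> 0" "?w \<noteq> 0"
    using assms by (auto simp: det_2 zero_prod_def add_eq_0_iff algebra_simps)
  from this(1)[THEN interior_halfspace_ge, of "A $ 1 $ 2 - A $ 2 $ 2"]
    this(2)[THEN interior_halfspace_ge, of "A $ 2 $ 2 + A $ 1 $ 2"]
  show "interior {q. 0 \<le> xi A q} = {q. 0 < xi A q}" "interior {q. 0 \<le> eta A q} = {q. 0 < eta A q}"
    unfolding xi_inner eta_inner by (simp_all add: algebra_simps)
qed

lemma interior_null_quadrant:
  assumes "det A \<noteq> 0" "open U"
  shows "interior {q. 0 \<le> xi A q \<and> 0 \<le> eta A q \<and> q \<in> U} = {q. 0 < xi A q \<and> 0 < eta A q \<and> q \<in> U}"
proof -
  have "{q. 0 \<le> xi A q \<and> 0 \<le> eta A q \<and> q \<in> U} = {q. 0 \<le> xi A q} \<inter> {q. 0 \<le> eta A q} \<inter> U" by auto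
  then show ?thesis
    using interior_null_ge[OF assms(1)] interior_open[OF assms(2)] by (auto simp: interior_Int)
qed

lemma curvature_par: "det A \<noteq> 0 \<Longrightarrow> curvature A = - 4 * (par_m A * par_n A)"
  by (simp add: curvature_def par_m_def par_n_def power2_eq_square field_simps)

text \<open>The point \<open>B\<close> is the intersection of \<open>\<eta> = 0\<close> with \<open>y = 0\<close>, so \<open>\<xi> = 1 / m\<close> at \<open>B\<close>.\<close>

lemma lam3_eq:
  assumes "det A \<noteq> 0" "par_m A \<noteq> 0"
  shows "lam3 A q = (1 - par_m A * xi A q) / par_m A"
proof -
  have ne: "A $ 2 $ 1 + A $ 1 $ 1 \<noteq> 0" using assms(2) by (auto simp: par_m_def)
  then have "lam1 A (B_pt A) * (A $ 2 $ 1 + A $ 1 $ 1) = - 2 * det A"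
    by (simp add: lam1_def B_pt_def det_2 field_simps)
  then have "lam1 A (B_pt A) = - 1 / par_m A"
    using ne assms by (simp add: par_m_def field_simps)
  then show ?thesis using assms(2) by (simp add: lam3_def xi_def field_simps)
qed

text \<open>For \<open>m n \<le> 0\<close> the conditions \<open>1 - m \<xi> > 0\<close> and \<open>1 + n \<eta> > 0\<close> follow from positive height, or from
the signs of \<open>m\<close> and \<open>n\<close>. For \<open>m n > 0\<close> both \<open>m\<close> and \<open>n\<close> are positive; then \<open>\<lambda>\<^sub>3 > 0\<close> says
\<open>1 - m \<xi> > 0\<close>, and \<open>1 + n \<eta> > 0\<close> is automatic.\<close>

lemma M_dom_eq:
  assumes A: "det A \<noteq> 0" "par_m A + par_n A \<ge> 0"
  shows "M_dom A = null_region A"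
proof (cases "curvature A \<ge> 0")
  case True
  then have k: "par_m A * par_n A \<le> 0" by (simp add: curvature_par[OF A(1)])
  have bounds: "0 < 1 - par_m A * xi A q \<and> 0 < 1 + par_n A * eta A q"
    if q: "0 < xi A q" "0 < eta A q" "0 < snd q" for q
  proof (cases "par_n A \<le> 0")
    case True
    then have "par_m A * xi A q \<ge> 0" "par_n A * eta A q \<le> 0"
      using A(2) q by (auto simp: mult_nonpos_nonneg)
    then show ?thesis using q(3) unfolding height_null[OF A(1)] by linarith
  next
    case False
    then have "par_m A \<le> 0" using k by (auto simp: mult_le_0_iff)
    then have "par_m A * xi A q \<le> 0" "par_n A * eta A q \<ge> 0"
      using q False by (auto simp: mult_nonpos_nonneg)
    then show ?thesis by linarith
  qed
  have "M_dom A = interior {q. 0 \<le> xi A q \<and> 0 \<le> eta A q \<and> q \<in> {q. 0 < snd q}}"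
    using True by (simp add: M_dom_def J_plus_eq)
  also have "\<dots> = {q. 0 < xi A q \<and> 0 < eta A q \<and> q \<in> {q. 0 < snd q}}"
    by (intro interior_null_quadrant A(1) open_Collect_less continuous_intros)
  also have "\<dots> = null_region A"
    using bounds by (auto simp: null_region_def)
  finally show ?thesis .
next
  case False
  then have k: "par_m A * par_n A > 0" by (simp add: curvature_par[OF A(1)])
  then have m: "par_m A > 0" "par_n A > 0" using A(2) by (auto simp: zero_less_mult_iff)
  have D: "D_dom A = {q. 0 \<le> xi A q \<and> 0 \<le> eta A q \<and> q \<in> {q. 0 < snd q \<and> 0 < 1 - par_m A * xi A q}}"
    using m lam3_eq[OF A(1)] by (auto simp: D_dom_def Aff_def xi_def eta_def zero_less_divide_iff)
  have "M_dom A = interior (D_dom A)" using False by (simp add: M_dom_def)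
  also have "\<dots> = {q. 0 < xi A q \<and> 0 < eta A q \<and> q \<in> {q. 0 < snd q \<and> 0 < 1 - par_m A * xi A q}}"
    unfolding D
    by (intro interior_null_quadrant A(1) open_Collect_conj open_Collect_less continuous_intros continuous_on_null)
  also have "\<dots> = null_region A"
    using m by (auto simp: null_region_def add_pos_nonneg)
  finally show ?thesis .
qed

section \<open>Optimality\<close>

lemma one_minus_mult_pos_between:
  fixes m x y :: real
  assumes "0 \<le> x" "x \<le> y" "0 < 1 - m * y"
  shows "0 < 1 - m * x"
proof (cases "m \<ge> 0")
  case True
  then show ?thesis using mult_left_mono[OF assms(2), of m] assms by linarith
next
  case False
  then have "m * x \<le> 0" using assms by (simp add: mult_nonpos_nonneg)
  then show ?thesis by linarith
qed

lemma moebius_mono: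
  fixes m x y :: real
  assumes "x \<le> y" "0 < 1 - m * x" "0 < 1 - m * y"
  shows "x / (1 - m * x) \<le> y / (1 - m * y)"
  using assms by (simp add: divide_simps) (simp add: algebra_simps)

lemma moebius_has_derivative:
  fixes u :: "real \<Rightarrow> real"
  assumes "(u has_real_derivative u') (at t)" "1 - m * u t \<noteq> 0"
  shows "((\<lambda>t. u t / (1 - m * u t)) has_real_derivative u' / (1 - m * u t)\<^sup>2) (at t)"
proof -
  have "((\<lambda>t. u t / (1 - m * u t)) has_real_derivative
      (u' * (1 - m * u t) - u t * (0 - m * u')) / ((1 - m * u t) * (1 - m * u t))) (at t)"
    by (intro DERIV_divide DERIV_diff DERIV_cmult DERIV_const assms)
  moreover have "u' * (1 - m * u t) - u t * (0 - m * u') = u'" by (simp add: algebra_simps)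
  ultimately show ?thesis by (simp add: power2_eq_square)
qed

text \<open>The infinitesimal calibration inequality. It is the inequality of the arithmetic and geometric means
for \<open>x' z\<close> and \<open>z' x\<close>.\<close>

lemma gatan_sqrt_derivative_ge:
  fixes x z :: "real \<Rightarrow> real"
  assumes x: "(x has_real_derivative x') (at t)" and z: "(z has_real_derivative z') (at t)"
    and pos: "x t > 0" "z t > 0" "1 + k * (x t * z t) > 0" and nn: "x' \<ge> 0" "z' \<ge> 0"
  obtains D where "((\<lambda>t. gatan k (sqrt (x t * z t))) has_real_derivative D) (at t)"
    and "sqrt (x' * z') / (1 + k * (x t * z t)) \<le> D"
proof -
  let ?T = "sqrt (x t * z t)"
  have T: "?T\<^sup>2 = x t * z t" "?T > 0" using pos by auto
  have "((\<lambda>t. sqrt (x t * z t)) has_real_derivative inverse ?T / 2 * (x' * z t + z' * x t)) (at t)"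
    by (rule DERIV_chain2[where f = sqrt and g = "\<lambda>t. x t * z t", OF DERIV_real_sqrt])
      (use pos in \<open>auto intro!: DERIV_mult x z\<close>)
  moreover have "(gatan k has_real_derivative 1 / (1 + k * (x t * z t))) (at ?T)"
    using gatan_has_derivative[of k ?T] T pos by simp
  ultimately have 1: "((\<lambda>t. gatan k (sqrt (x t * z t))) has_real_derivative
      1 / (1 + k * (x t * z t)) * (inverse ?T / 2 * (x' * z t + z' * x t))) (at t)"
    by (rule DERIV_chain2[rotated])
  have "sqrt (x' * z') * ?T = sqrt ((x' * z t) * (z' * x t))"
    by (simp add: real_sqrt_mult[symmetric] mult_ac)
  also have "\<dots> \<le> (x' * z t + z' * x t) / 2"
    using pos nn by (intro arith_geo_mean_sqrt) auto
  finally have "sqrt (x' * z') \<le> inverse ?T / 2 * (x' * z t + z' * x t)"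
    using T(2) by (simp add: field_simps)
  then have "sqrt (x' * z') / (1 + k * (x t * z t)) \<le> 1 / (1 + k * (x t * z t)) * (inverse ?T / 2 * (x' * z t + z' * x t))"
    unfolding times_divide_eq_left mult_1_left using pos(3) by (intro divide_right_mono) auto
  with 1 show ?thesis by (rule that)
qed

lemma sqrt_lorentz_form:
  "sqrt (- lorentz_form A q w) = sqrt ((vcoords A q w $ 1 - vcoords A q w $ 2) * (vcoords A q w $ 1 + vcoords A q w $ 2))"
  by (simp add: lorentz_form_def power2_eq_square algebra_simps)

text \<open>The calibration: the second component of \<open>Log\<close> is compared with the length. The whole curve lies where
\<open>1 - m \<xi>\<close> and \<open>1 + n \<eta>\<close> are positive, because \<open>\<xi>\<close> and \<open>\<eta>\<close> stay between \<open>0\<close> and their final values, at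
which the two affine functions are positive. At an interior time at which \<open>\<xi>\<close> or \<open>\<eta>\<close> vanishes it has a
minimum, so its derivative and hence the length element are \<open>0\<close>.\<close>

lemma lorentz_length_le:
  assumes A: "det A \<noteq> 0" and c: "causal_curve A s t q"
    and e: "q s = aff_id" "q t \<in> null_region A"
  shows "lorentz_length A s t q \<le> snd (Log A (q t))"
proof -
  let ?m = "par_m A" and ?n = "par_n A"
  let ?k = "?m * ?n"
  have st: "s \<le> t" using c by (auto simp: causal_curve_def)
  have ae: "AE r in lebesgue. r \<in> {s..t} \<longrightarrow> q differentiable (at r) \<and>
      future_nonspacelike A (q r) (vector_derivative q (at r))"
    and y: "\<And>r. r \<in> {s..t} \<Longrightarrow> snd (q r) > 0"
    using c by (auto simp: causal_curve_def Aff_def image_subset_iff)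
  have mono: "xi A (q p) \<le> xi A (q r)" "eta A (q p) \<le> eta A (q r)"
    if "p \<in> {s..t}" "r \<in> {s..t}" "p \<le> r" for p r
    using causal_curve_mono_null[OF c, THEN mono_onD, OF that] by auto
  have nn: "0 \<le> xi A (q r)" "0 \<le> eta A (q r)" if "r \<in> {s..t}" for r
    using mono[of s r] that st by (auto simp: e)
  have p: "0 < 1 - ?m * xi A (q r)" "0 < 1 + ?n * eta A (q r)" if r: "r \<in> {s..t}" for r
  proof -
    have "xi A (q r) \<le> xi A (q t)" "eta A (q r) \<le> eta A (q t)" using mono[OF r] r by auto
    then show "0 < 1 - ?m * xi A (q r)" "0 < 1 + ?n * eta A (q r)"
      using e(2) nn[OF r] one_minus_mult_pos_between[of "xi A (q r)" "xi A (q t)" ?m]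
        one_minus_mult_pos_between[of "eta A (q r)" "eta A (q t)" "- ?n"]
      by (auto simp: null_region_def)
  qed
  define X where "X r = conf_x A (q r)" for r
  define Z where "Z r = conf_z A (q r)" for r
  define G where "G r = gatan ?k (sqrt (X r * Z r))" for r
  have XZ: "X r \<ge> 0" "Z r \<ge> 0" "1 + ?k * (X r * Z r) > 0" if r: "r \<in> {s..t}" for r
  proof -
    show "X r \<ge> 0" "Z r \<ge> 0" using nn[OF r] p[OF r] by (auto simp: X_def Z_def conf_x_def conf_z_def)
    have "0 < (1 - ?m * xi A (q r)) * (1 + ?n * eta A (q r))" using p[OF r] by simp
    then show "1 + ?k * (X r * Z r) > 0"
      unfolding X_def Z_def using conf_height[OF A, of "q r"] y[OF r] p[OF r]
      by (metis less_irrefl zero_less_mult_pos2)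
  qed
  have "mono_on {s..t} G"
  proof (rule mono_onI)
    fix a b assume ab: "a \<in> {s..t}" "b \<in> {s..t}" "a \<le> b"
    have "X a \<le> X b" "Z a \<le> Z b"
      using moebius_mono[OF mono(1)[OF ab], of ?m] moebius_mono[OF mono(2)[OF ab], of "- ?n"] p[OF ab(1)] p[OF ab(2)]
      by (auto simp: X_def Z_def conf_x_def conf_z_def)
    then have "X a * Z a \<le> X b * Z b" using XZ[OF ab(1)] by (intro mult_mono) auto
    then show "G a \<le> G b"
      unfolding G_def using XZ[OF ab(1)] XZ[OF ab(2)] by (intro gatan_mono) auto
  qed
  then have "lorentz_length A s t q \<le> G t - G s"
    unfolding lorentz_length_def
  proof (rule integral_derivative_mono_le[OF st])
    show "AE r in lebesgue. r \<in> {s<..<t} \<longrightarrow>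
        sqrt (- lorentz_form A (q r) (vector_derivative q (at r))) = 0 \<or>
        (\<exists>D. (G has_real_derivative D) (at r) \<and>
          0 \<le> sqrt (- lorentz_form A (q r) (vector_derivative q (at r))) \<and>
          sqrt (- lorentz_form A (q r) (vector_derivative q (at r))) \<le> D)"
      using ae
    proof eventually_elim
      case (elim r)
      show ?case
      proof
        assume "r \<in> {s<..<t}"
        then have r: "r \<in> {s..t}" "s < r" "r < t" by auto
        define w where "w = vector_derivative q (at r)"
        define f where "f = vcoords A (q r) w $ 1 - vcoords A (q r) w $ 2"
        define g where "g = vcoords A (q r) w $ 1 + vcoords A (q r) w $ 2"
        have d: "(q has_vector_derivative w) (at r)"
          using elim r vector_derivative_works unfolding w_def by blast
        have fg: "0 \<le> f" "0 \<le> g" using elim r by (auto simp: future_nonspacelike_def w_def f_def g_def)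
        have h: "sqrt (- lorentz_form A (q r) (vector_derivative q (at r))) = sqrt (f * g)"
          by (simp add: sqrt_lorentz_form f_def g_def w_def)
        have y0: "snd (q r) \<noteq> 0" using y[OF r(1)] by simp
        have du: "((\<lambda>r. xi A (q r)) has_real_derivative snd (q r) * f) (at r)"
          and dv: "((\<lambda>r. eta A (q r)) has_real_derivative snd (q r) * g) (at r)"
          using null_coordinate_derivatives[OF d y0, of A] by (auto simp: f_def g_def)
        define \<delta> where "\<delta> = min (r - s) (t - r)"
        have \<delta>: "\<delta> > 0" "\<And>x. \<bar>r - x\<bar> < \<delta> \<Longrightarrow> x \<in> {s..t}" using r by (auto simp: \<delta>_def)
        consider "xi A (q r) = 0" | "eta A (q r) = 0" | "xi A (q r) > 0" "eta A (q r) > 0"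
          using nn[OF r(1)] by linarith
        then show "sqrt (- lorentz_form A (q r) (vector_derivative q (at r))) = 0 \<or>
          (\<exists>D. (G has_real_derivative D) (at r) \<and>
            0 \<le> sqrt (- lorentz_form A (q r) (vector_derivative q (at r))) \<and>
            sqrt (- lorentz_form A (q r) (vector_derivative q (at r))) \<le> D)"
        proof cases
          case 1
          have "snd (q r) * f = 0"
            by (rule DERIV_local_min[OF du \<delta>(1)]) (use 1 nn \<delta>(2) in auto)
          then show ?thesis using h y0 by simp
        next
          case 2
          have "snd (q r) * g = 0"
            by (rule DERIV_local_min[OF dv \<delta>(1)]) (use 2 nn \<delta>(2) in auto)
          then show ?thesis using h y0 by simp
        next
          case 3
          have dX: "(X has_real_derivative snd (q r) * f / (1 - ?m * xi A (q r))\<^sup>2) (at r)"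
            unfolding X_def conf_x_def using p[OF r(1)]
            by (intro moebius_has_derivative du) simp
          have dZ: "(Z has_real_derivative snd (q r) * g / (1 + ?n * eta A (q r))\<^sup>2) (at r)"
            using moebius_has_derivative[OF dv, of "- ?n"] p[OF r(1)]
            unfolding Z_def conf_z_def by simp
          have pos: "X r > 0" "Z r > 0"
            using 3 p[OF r(1)] by (auto simp: X_def Z_def conf_x_def conf_z_def)
          obtain D where D: "(G has_real_derivative D) (at r)"
            "sqrt ((snd (q r) * f / (1 - ?m * xi A (q r))\<^sup>2) * (snd (q r) * g / (1 + ?n * eta A (q r))\<^sup>2))
              / (1 + ?k * (X r * Z r)) \<le> D"
            unfolding G_def
            by (rule gatan_sqrt_derivative_ge[OF dX dZ pos XZ(3)[OF r(1)]])
              (use fg y[OF r(1)] in auto)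
          let ?a = "1 - ?m * xi A (q r)" and ?b = "1 + ?n * eta A (q r)"
          have ab: "0 < ?a" "0 < ?b" using p[OF r(1)] .
          have "(snd (q r) * f / ?a\<^sup>2) * (snd (q r) * g / ?b\<^sup>2) = (snd (q r) / (?a * ?b))\<^sup>2 * (f * g)"
            by (simp add: power2_eq_square field_simps)
          then have "sqrt ((snd (q r) * f / ?a\<^sup>2) * (snd (q r) * g / ?b\<^sup>2)) = snd (q r) / (?a * ?b) * sqrt (f * g)"
            using y[OF r(1)] ab by (simp add: real_sqrt_mult)
          moreover have "snd (q r) / (?a * ?b) = 1 + ?k * (X r * Z r)"
            using conf_height[OF A, of "q r"] ab by (simp add: X_def Z_def)
          ultimately have "sqrt (f * g) \<le> D" using D(2) XZ(3)[OF r(1)] by simp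
          then show ?thesis using D(1) h fg by auto
        qed
      qed
    qed
  qed
  moreover have "G s = 0" by (simp add: G_def X_def conf_x_def e)
  ultimately show ?thesis by (simp add: G_def X_def Z_def Log_def)
qed

lemma Exp_has_vector_derivative:
  assumes A: "det A \<noteq> 0" and t: "t \<in> geo_int A p"
  obtains r where "((\<lambda>t. Exp A (p, t)) has_vector_derivative
    cosh r *\<^sub>R Y1 A (Exp A (p, t)) + sinh r *\<^sub>R Y2 A (Exp A (p, t))) (at t)"
proof -
  obtain psi where "extremal_on A p (geo_int A p) psi (geo A p)"
    using extremal_on_geo[OF A] by blast
  then have "(geo A p has_vector_derivative
      cosh (psi t) *\<^sub>R Y1 A (geo A p t) + sinh (psi t) *\<^sub>R Y2 A (geo A p t)) (at t)"
    using t by (auto simp: extremal_on_def)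
  then have "((\<lambda>t. Exp A (p, t)) has_vector_derivative
      cosh (psi t) *\<^sub>R Y1 A (geo A p t) + sinh (psi t) *\<^sub>R Y2 A (geo A p t)) (at t)"
    by (rule has_vector_derivative_transform_within_open[OF _ geo_int_props(1) t])
      (simp add: Exp_eq_geo[OF A])
  then show ?thesis using that Exp_eq_geo[OF A t] by metis
qed

text \<open>The velocity is continuous, so it is bounded on a compact time interval.\<close>

lemma lipschitz_geo:
  assumes A: "det A \<noteq> 0" and t: "{0..t} \<subseteq> geo_int A p"
  shows "\<exists>L. L-lipschitz_on {0..t} (geo A p)"
proof -
  obtain psi where ex: "extremal_on A p (geo_int A p) psi (geo A p)"
    using extremal_on_geo[OF A] by blast
  define W where "W r = cosh (psi r) *\<^sub>R Y1 A (geo A p r) + sinh (psi r) *\<^sub>R Y2 A (geo A p r)" for r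
  note h = ex[unfolded extremal_on_def]
  have d: "(geo A p has_vector_derivative W r) (at r)" if "r \<in> {0..t}" for r
    using h that t unfolding W_def by blast
  have "isCont psi r" if "r \<in> {0..t}" for r
    using h that t DERIV_isCont by blast
  moreover have "isCont (geo A p) r" if "r \<in> {0..t}" for r
    using has_vector_derivative_continuous[OF d[OF that]] .
  ultimately have c: "continuous_on {0..t} psi" "continuous_on {0..t} (geo A p)"
    by (simp_all add: continuous_at_imp_continuous_on)
  have "continuous_on {0..t} W"
    unfolding W_def extremal_velocity[OF A] of_null_def
    by (intro continuous_intros c) (use A in auto)
  then have "bounded (W ` {0..t})"
    by (intro compact_imp_bounded compact_continuous_image) auto
  then obtain B where B: "0 < B" "\<And>r. r \<in> {0..t} \<Longrightarrow> norm (W r) \<le> B"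
    by (auto simp: bounded_pos)
  have "B-lipschitz_on {0..t} (geo A p)"
  proof (rule bounded_derivative_imp_lipschitz)
    show "(geo A p has_derivative (\<lambda>x. x *\<^sub>R W r)) (at r within {0..t})" if "r \<in> {0..t}" for r
      using d[OF that] unfolding has_vector_derivative_def by (rule has_derivative_at_withinI)
    show "onorm (\<lambda>x. x *\<^sub>R W r) \<le> B" if "r \<in> {0..t}" for r
      using B(2)[OF that] by (intro onorm_bound) (auto simp: mult.commute[of B] mult_left_mono less_imp_le[OF B(1)])
  qed (use B in auto)
  then show ?thesis by blast
qed

text \<open>Extremals have \<open>v\<^sub>1 = cosh \<psi>\<close> and \<open>v\<^sub>2 = sinh \<psi>\<close>: they are timelike and parametrised by arclength.\<close>

lemma causal_curve_Exp:
  assumes A: "det A \<noteq> 0" and t: "0 \<le> t" "t \<in> geo_int A p"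
  shows "causal_curve A 0 t (\<lambda>t. Exp A (p, t))" "lorentz_length A 0 t (\<lambda>t. Exp A (p, t)) = t"
proof -
  let ?q = "\<lambda>t. Exp A (p, t)"
  have sub: "{0..t} \<subseteq> geo_int A p"
    using mem_is_interval_1_I[OF geo_int_props(2,3) t(2)] by auto
  have y: "snd (?q r) > 0" if "r \<in> geo_int A p" for r
    using snd_geo[OF that] Exp_eq_geo[OF A that] geo_int_props(4,5)[OF that] by simp
  have key: "?q differentiable (at r) \<and> vcoords A (?q r) (vector_derivative ?q (at r)) $ 1
      \<ge> \<bar>vcoords A (?q r) (vector_derivative ?q (at r)) $ 2\<bar> \<and>
      - lorentz_form A (?q r) (vector_derivative ?q (at r)) = 1" if r: "r \<in> geo_int A p" for r
  proof -
    have y0: "snd (?q r) \<noteq> 0" using y[OF r] by simp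
    obtain s where d: "(?q has_vector_derivative cosh s *\<^sub>R Y1 A (?q r) + sinh s *\<^sub>R Y2 A (?q r)) (at r)"
      using Exp_has_vector_derivative[OF A r] by blast
    note v = vcoords_extremal_velocity[OF A y0, of s]
    have "\<bar>sinh s\<bar> \<le> cosh s"
      using sinh_le_cosh_real[of s] sinh_le_cosh_real[of "- s"] by (auto simp: abs_le_iff)
    moreover have "?q differentiable (at r)"
      using d has_vector_derivative_def differentiable_def by blast
    ultimately show ?thesis
      unfolding vector_derivative_at[OF d] lorentz_form_def v by (simp add: cosh_square_eq)
  qed
  obtain L where "L-lipschitz_on {0..t} (geo A p)" using lipschitz_geo[OF A sub] by blast
  then have "L-lipschitz_on {0..t} ?q"
    by (rule lipschitz_on_transform) (use Exp_eq_geo[OF A] sub in auto)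
  moreover have "?q ` {0..t} \<subseteq> Aff" using y sub unfolding Aff_def by blast
  moreover have "AE r in lebesgue. r \<in> {0..t} \<longrightarrow> ?q differentiable (at r) \<and>
      future_nonspacelike A (?q r) (vector_derivative ?q (at r))"
    unfolding future_nonspacelike_def using key sub by (intro AE_I2) blast
  ultimately show "causal_curve A 0 t ?q"
    unfolding causal_curve_def using t by blast
  have "lorentz_length A 0 t ?q = (LINT r:{0..t}|lebesgue. (1::real))"
    unfolding lorentz_length_def
    using key sub by (intro set_lebesgue_integral_cong) (auto simp: subset_iff)
  also have "\<dots> = t" using t by (simp add: set_integral_const)
  finally show "lorentz_length A 0 t ?q = t" .
qed

theorem theorem11:
  fixes A :: "real ^ 2 ^ 2"
  assumes "det A > 0" and "A $ 1 $ 1 \<ge> 0"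
  shows "Exp A ` N_dom A \<subseteq> M_dom A \<and>
     diffeomorphism_between (N_dom A) (M_dom A) (Exp A) \<and>
     (\<forall>\<psi>0 t1. 0 < t1 \<and> ereal t1 < t_max A \<psi>0 \<longrightarrow>
           length_maximizer A 0 t1 (\<lambda>t. Exp A (\<psi>0, t)))"
proof -
  have A: "det A \<noteq> 0" "par_m A + par_n A \<ge> 0" using par_sum_nonneg assms by auto
  have diffeo: "diffeomorphism_between (N_dom A) (M_dom A) (Exp A)"
    unfolding M_dom_eq[OF A] by (rule diffeomorphism_Exp[OF A])
  then have "Exp A ` N_dom A \<subseteq> M_dom A"
    by (auto simp: diffeomorphism_between_def homeomorphism_def)
  moreover have "length_maximizer A 0 t (\<lambda>t. Exp A (p, t))" if t: "0 < t" "ereal t < t_max A p" for p t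
    unfolding length_maximizer_def
  proof (intro conjI allI impI)
    have N: "(p, t) \<in> N_dom A" using t by (simp add: N_dom_def)
    then have I: "t \<in> geo_int A p" using N_dom_iff_geo_int[OF A(1)] by blast
    note E = Exp_eq_geo[OF A(1)]
    show "causal_curve A 0 t (\<lambda>t. Exp A (p, t))" using causal_curve_Exp[OF A(1) _ I] t by simp
    fix s' t' q
    assume q: "causal_curve A s' t' q \<and> q s' = Exp A (p, 0) \<and> q t' = Exp A (p, t)"
    have "geo A p 0 = aff_id" by (simp add: geo_def Let_def)
    then have "q s' = aff_id" using q E[OF geo_int_props(3)] by simp
    moreover have qt: "q t' = geo A p t" using q E[OF I] by simp
    moreover have "causal_curve A s' t' q" using q by blast
    ultimately have "lorentz_length A s' t' q \<le> snd (Log A (q t'))"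
      using lorentz_length_le[OF A(1)] geo_in_null_region(1)[OF A N] by metis
    also have "\<dots> = t" using geo_in_null_region(2)[OF A N] qt by simp
    also have "\<dots> = lorentz_length A 0 t (\<lambda>t. Exp A (p, t))"
      using causal_curve_Exp(2)[OF A(1) _ I] t by simp
    finally show "lorentz_length A s' t' q \<le> lorentz_length A 0 t (\<lambda>t. Exp A (p, t))" .
  qed
  ultimately show ?thesis using diffeo by blast
qed

end
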